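(* Let $d\ge3$. There exist constants $0<c_{13}<c_{12}$ depending only on $d$ such that for every $u>0$, $$\lim_{N\to\infty}P\big[L_2\le\hat L(uN^d)\le L_1\big]=1,$$ where $L_1=\Big[c_{12}\Big(\frac{\log N}u\Big)^{\frac1{d-2}}\Big]$, $L_2=\Big[c_{13}\Big(\frac{\log N}u\Big)^{\frac1{d-2}}\Big]$, and for $t\ge0$ $$\hat L(t)=\sup\{m\ge0:\ m \text{ integer},\ X_{[0,t]}\cap B(x,m)=\emptyset\text{ for some }x\in E\},$$ with the convention $\hat L(t)=0$ when the set on the right-hand side is empty.
   Context: $[\cdot]$ denotes integer part. $E=(\mathbb Z/N\mathbb Z)^d$ is the discrete torus, and $B(x,m)$ is the closed ball in $E$ of center $x$ and radius $m$ for the $\ell^\infty$-distance. $P$ is the law of simple random walk $(X_n)_{n\ge0}$ on $E$ (each step adds one of $\pm e_1,\dots,\pm e_d$ with probability $1/(2d)$) started from the uniform distribution. $X_{[0,t]}=\{X_n:0\le n\le t\}$. *)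

theory Defs
  imports "HOL-Probability.Probability"
begin

text \<open>
  The torus \<open>(\<int>/N\<int>)\<^sup>d\<close>: every class is represented by its residues in \<open>{0..<N}\<close>; points are
  functions on \<open>{..<d}\<close>, extended by \<open>undefined\<close>.
\<close>

definition torus :: "nat \<Rightarrow> nat \<Rightarrow> (nat \<Rightarrow> int) set" where
  "torus N d = {..<d} \<rightarrow>\<^sub>E {0..<int N}"

text \<open>
  The distance of two residue classes in \<open>\<int>/N\<int>\<close>, i.e. the least \<open>\<bar>a - b + k * N\<bar>\<close> with \<open>k\<close> an integer.
\<close>

definition cyc_dist :: "nat \<Rightarrow> int \<Rightarrow> int \<Rightarrow> int" where
  "cyc_dist N a b = min ((a - b) mod int N) ((b - a) mod int N)"

definition torus_dist :: "nat \<Rightarrow> nat \<Rightarrow> (nat \<Rightarrow> int) \<Rightarrow> (nat \<Rightarrow> int) \<Rightarrow> int" where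
  "torus_dist N d x y = Max ((\<lambda>i. cyc_dist N (x i) (y i)) ` {..<d})"

definition torus_ball :: "nat \<Rightarrow> nat \<Rightarrow> (nat \<Rightarrow> int) \<Rightarrow> nat \<Rightarrow> (nat \<Rightarrow> int) set" where
  "torus_ball N d x m = {y \<in> torus N d. torus_dist N d x y \<le> int m}"

text \<open>
  The pair \<open>(i, s)\<close> stands for the increment \<open>s * e\<^sub>i\<close>. Increments are sampled as such pairs, so
  that for \<open>N \<le> 2\<close>, where \<open>e\<^sub>i = - e\<^sub>i\<close>, both signs still count separately.
\<close>

definition step_set :: "nat \<Rightarrow> (nat \<times> int) set" where
  "step_set d = {..<d} \<times> {-1, 1}"

definition torus_step :: "nat \<Rightarrow> (nat \<Rightarrow> int) \<Rightarrow> nat \<times> int \<Rightarrow> (nat \<Rightarrow> int)" where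
  "torus_step N x = (\<lambda>(i, s). x(i := (x i + s) mod int N))"

primrec walk_path :: "nat \<Rightarrow> (nat \<Rightarrow> int) \<Rightarrow> (nat \<Rightarrow> nat \<times> int) \<Rightarrow> nat \<Rightarrow> (nat \<Rightarrow> int)" where
  "walk_path N x \<xi> 0 = x"
| "walk_path N x \<xi> (Suc n) = torus_step N (walk_path N x \<xi> n) (\<xi> n)"

text \<open>
  The law of the walk on the path space \<open>\<nat> \<rightarrow> torus N d\<close>: image of a uniform starting point and an
  independent i.i.d. sequence of uniform increments. Under it \<open>X\<^sub>n\<close> is the coordinate \<open>\<omega> n\<close>.
\<close>

definition step_seq_law :: "nat \<Rightarrow> (nat \<Rightarrow> nat \<times> int) measure" where
  "step_seq_law d = (\<Pi>\<^sub>M n\<in>UNIV. uniform_count_measure (step_set d))"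

definition walk_law :: "nat \<Rightarrow> nat \<Rightarrow> (nat \<Rightarrow> nat \<Rightarrow> int) measure" where
  "walk_law N d =
     distr (uniform_count_measure (torus N d) \<Otimes>\<^sub>M step_seq_law d)
       (\<Pi>\<^sub>M n\<in>UNIV. count_space (torus N d)) (\<lambda>(x, \<xi>). walk_path N x \<xi>)"

definition visited :: "(nat \<Rightarrow> nat \<Rightarrow> int) \<Rightarrow> real \<Rightarrow> (nat \<Rightarrow> int) set" where
  "visited \<omega> t = {\<omega> n | n. real n \<le> t}"

text \<open>
  On \<open>nat\<close>, the supremum of the empty set is 0, as the convention requires. For \<open>t \<ge> 0\<close> and a path in
  the torus the set is bounded, since a ball of radius \<open>N\<close> is the whole torus.
\<close>

definition L_hat :: "nat \<Rightarrow> nat \<Rightarrow> (nat \<Rightarrow> nat \<Rightarrow> int) \<Rightarrow> real \<Rightarrow> nat" where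
  "L_hat N d \<omega> t = Sup {m. \<exists>x\<in>torus N d. visited \<omega> t \<inter> torus_ball N d x m = {}}"

definition radius :: "nat \<Rightarrow> real \<Rightarrow> nat \<Rightarrow> real \<Rightarrow> int" where
  "radius d c N u = \<lfloor>c * (ln (real N) / u) powr (1 / (real d - 2))\<rfloor>"


text \<open>Well-definedness: the law is a probability measure and \<open>L_hat\<close> is a random variable.\<close>

lemma finite_torus: "finite (torus N d)"
  by (simp add: torus_def finite_PiE)

lemma torus_nonempty: "N > 0 \<Longrightarrow> torus N d \<noteq> {}"
  by (auto simp: torus_def PiE_eq_empty_iff)

lemma torus_step_in:
  assumes "N > 0" "x \<in> torus N d" "s \<in> step_set d"
  shows "torus_step N x s \<in> torus N d"
  using assms by (auto simp: torus_step_def torus_def step_set_def PiE_def extensional_def Pi_def)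

lemma walk_path_in_torus:
  assumes "N > 0" "x \<in> torus N d" "\<And>n. \<xi> n \<in> step_set d"
  shows "walk_path N x \<xi> n \<in> torus N d"
  by (induction n) (use assms in \<open>auto intro: torus_step_in\<close>)

lemma space_step_seq_law: "space (step_seq_law d) = {\<xi>. \<forall>n. \<xi> n \<in> step_set d}"
  by (auto simp: step_seq_law_def space_PiM space_uniform_count_measure)

lemma prob_space_step_seq_law: "d > 0 \<Longrightarrow> prob_space (step_seq_law d)"
  unfolding step_seq_law_def
  by (intro prob_space_PiM prob_space_uniform_count_measure) (auto simp: step_set_def)

lemma measurable_walk_path_nth:
  assumes "N > 0"
  shows "(\<lambda>(x, \<xi>). walk_path N x \<xi> n) \<in>
    uniform_count_measure (torus N d) \<Otimes>\<^sub>M step_seq_law d \<rightarrow>\<^sub>M count_space (torus N d)"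
proof (induction n)
  case 0
  have "fst \<in> uniform_count_measure (torus N d) \<Otimes>\<^sub>M step_seq_law d
      \<rightarrow>\<^sub>M uniform_count_measure (torus N d)"
    by (rule measurable_fst)
  also have "(uniform_count_measure (torus N d) \<Otimes>\<^sub>M step_seq_law d
      \<rightarrow>\<^sub>M uniform_count_measure (torus N d)) =
      (uniform_count_measure (torus N d) \<Otimes>\<^sub>M step_seq_law d \<rightarrow>\<^sub>M count_space (torus N d))"
    by (intro measurable_cong_sets) (auto simp: sets_uniform_count_measure)
  finally show ?case by (simp add: case_prod_unfold)
next
  case (Suc n)
  let ?M = "uniform_count_measure (torus N d) \<Otimes>\<^sub>M step_seq_law d"
  have "(\<lambda>p. snd p n) \<in> ?M \<rightarrow>\<^sub>M uniform_count_measure (step_set d)"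
    unfolding step_seq_law_def by measurable
  also have "(?M \<rightarrow>\<^sub>M uniform_count_measure (step_set d)) = (?M \<rightarrow>\<^sub>M count_space (step_set d))"
    by (intro measurable_cong_sets) (auto simp: sets_uniform_count_measure)
  finally have s: "(\<lambda>p. snd p n) \<in> ?M \<rightarrow>\<^sub>M count_space (step_set d)" .
  have w: "(\<lambda>p. walk_path N (fst p) (snd p) n) \<in> ?M \<rightarrow>\<^sub>M count_space (torus N d)"
    using Suc by (simp add: case_prod_unfold)
  have eq: "count_space (torus N d) \<Otimes>\<^sub>M count_space (step_set d)
      = count_space (torus N d \<times> step_set d)"
    by (intro pair_measure_count_space finite_torus) (auto simp: step_set_def)
  have p: "(\<lambda>p. (walk_path N (fst p) (snd p) n, snd p n)) \<in> ?M
      \<rightarrow>\<^sub>M count_space (torus N d \<times> step_set d)"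
    unfolding eq[symmetric] using w s by (rule measurable_Pair)
  have t: "(\<lambda>(x, s). torus_step N x s) \<in> count_space (torus N d \<times> step_set d)
      \<rightarrow>\<^sub>M count_space (torus N d)"
    using torus_step_in[OF assms] by auto
  show ?case
    using measurable_compose[OF p t] by (simp add: case_prod_unfold)
qed

lemma measurable_walk_path:
  assumes "N > 0"
  shows "(\<lambda>(x, \<xi>). walk_path N x \<xi>) \<in> uniform_count_measure (torus N d) \<Otimes>\<^sub>M step_seq_law d
    \<rightarrow>\<^sub>M (\<Pi>\<^sub>M n\<in>UNIV. count_space (torus N d))"
  by (rule measurable_PiM_single')
     (use measurable_walk_path_nth[OF assms] walk_path_in_torus[OF assms] in
       \<open>auto simp: case_prod_unfold space_pair_measure space_uniform_count_measure space_step_seq_law\<close>)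

lemma prob_space_walk_law:
  assumes "N > 0" "d > 0"
  shows "prob_space (walk_law N d)"
proof -
  interpret A: prob_space "uniform_count_measure (torus N d)"
    by (intro prob_space_uniform_count_measure finite_torus torus_nonempty assms)
  interpret B: prob_space "step_seq_law d"
    by (rule prob_space_step_seq_law[OF assms(2)])
  interpret pair_prob_space "uniform_count_measure (torus N d)" "step_seq_law d" ..
  show ?thesis
    unfolding walk_law_def by (rule prob_space_distr[OF measurable_walk_path[OF assms(1)]])
qed

lemma measurable_L_hat: "(\<lambda>\<omega>. L_hat N d \<omega> t) \<in> walk_law N d \<rightarrow>\<^sub>M count_space UNIV"
proof -
  have [measurable]: "Measurable.pred (walk_law N d) (\<lambda>\<omega>. \<omega> n \<in> B)" for n B
  proof -
    have "(\<lambda>\<omega>. \<omega> n) \<in> walk_law N d \<rightarrow>\<^sub>M count_space (torus N d)"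
      unfolding walk_law_def by simp
    moreover have "(\<lambda>y. y \<in> B) \<in> count_space (torus N d) \<rightarrow>\<^sub>M count_space UNIV"
      by simp
    ultimately show ?thesis by (rule measurable_compose)
  qed
  have eq: "(\<exists>x\<in>torus N d. visited \<omega> t \<inter> torus_ball N d x m = {}) \<longleftrightarrow>
      (\<exists>x\<in>torus N d. \<forall>n. real n \<le> t \<longrightarrow> \<omega> n \<notin> torus_ball N d x m)" for \<omega> m
    by (auto simp: visited_def)
  have [measurable]: "Measurable.pred (walk_law N d)
      (\<lambda>\<omega>. \<exists>x\<in>torus N d. visited \<omega> t \<inter> torus_ball N d x m = {})" for m
    unfolding eq by (intro pred_intros_finite finite_torus) measurable
  show ?thesis
    unfolding L_hat_def by (rule measurable_Sup_nat) measurable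
qed

end

theory Submission
  imports Defs "HOL-Real_Asymp.Real_Asymp"
begin

text \<open>
  Both bounds come from estimates of hitting probabilities of balls that hold for every starting point.
  The Green function is that of the lazy walk: its eigenvalues \<open>1 - (1/d) \<Sum>\<^sub>i sin\<^sup>2 (\<pi> k\<^sub>i / N)\<close> are
  nonnegative, so parity plays no role, and a Fourier sum bounds its kernel at time \<open>n\<close> by
  \<open>C (N\<^sup>-\<^sup>d + n\<^sup>-\<^sup>d\<^sup>/\<^sup>2)\<close>. Since the lazy walk visits the same points as the walk, only later, the
  maximum principle transfers its Green function estimates to the walk itself.

  Upper bound: within a time \<open>2 K\<close> with \<open>N\<^sup>2 \<lless> K \<lless> N\<^sup>d / m\<^sup>d\<^sup>-\<^sup>2\<close> (up to logarithms) a ball of radius \<open>m\<close>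
  is hit with probability at least \<open>c K m\<^sup>d\<^sup>-\<^sup>2 / N\<^sup>d\<close>, whatever the starting point. By the Markov property
  it is missed up to time \<open>u N\<^sup>d\<close> with probability at most \<open>exp (- c u m\<^sup>d\<^sup>-\<^sup>2)\<close> (with another constant
  \<open>c\<close>), and a union bound over the centers concludes.

  Lower bound: take about \<open>\<surd>N\<close> balls at mutual distance about \<open>\<surd>N\<close> and kill the walk at a rate
  \<open>\<theta>\<close> of order \<open>m\<^sup>d\<^sup>-\<^sup>2 / N\<^sup>d\<close> so that from one ball any other one is reached with probability at most \<open>1/2\<close>.
  Matthews' argument then shows that all \<open>q\<close> balls are reached with probability at most \<open>2 / (q + 1)\<close>,
  and removing the killing up to time \<open>u N\<^sup>d\<close> costs a factor which is a small power of \<open>N\<close>.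
\<close>

section \<open>The averaging operator of the walk\<close>

locale torus_walk =
  fixes N d :: nat
  assumes N_pos: "N > 0" and d_pos: "d > 0"
begin

definition avg :: "((nat \<Rightarrow> int) \<Rightarrow> real) \<Rightarrow> (nat \<Rightarrow> int) \<Rightarrow> real" where
  "avg f x = (\<Sum>s\<in>step_set d. f (torus_step N x s)) / real (2 * d)"

text \<open>The iterate \<open>(lazy ^^ n) (indicator A) x\<close> is the probability that the lazy
  walk, which stays put with probability 1/2 at each step, is in \<open>A\<close> at time
  \<open>n\<close> when started from \<open>x\<close>.\<close>

definition lazy :: "((nat \<Rightarrow> int) \<Rightarrow> real) \<Rightarrow> (nat \<Rightarrow> int) \<Rightarrow> real" where
  "lazy f x = (f x + avg f x) / 2"

lemma finite_step_set [simp]: "finite (step_set d)"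
  by (simp add: step_set_def)

lemma card_step_set: "card (step_set d) = 2 * d"
  by (simp add: step_set_def card_cartesian_product)

lemma step_in_torus: "x \<in> torus N d \<Longrightarrow> s \<in> step_set d \<Longrightarrow> torus_step N x s \<in> torus N d"
  by (rule torus_step_in[OF N_pos])

lemma avg_mono:
  assumes "x \<in> torus N d" "\<And>y. y \<in> torus N d \<Longrightarrow> f y \<le> g y"
  shows "avg f x \<le> avg g x"
  unfolding avg_def using assms by (intro divide_right_mono sum_mono) (auto intro: step_in_torus)

lemma avg_cong:
  assumes "x \<in> torus N d" "\<And>y. y \<in> torus N d \<Longrightarrow> f y = g y"
  shows "avg f x = avg g x"
  using avg_mono[of x f g] avg_mono[of x g f] assms by force

lemma avg_const [simp]: "avg (\<lambda>_. c) x = c"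
  using d_pos by (simp add: avg_def card_step_set)

lemma avg_add: "avg (\<lambda>y. f y + g y) x = avg f x + avg g x"
  by (simp add: avg_def sum.distrib add_divide_distrib)

lemma avg_cmult: "avg (\<lambda>y. c * f y) x = c * avg f x"
  by (simp add: avg_def sum_distrib_left)

lemma avg_sum: "avg (\<lambda>y. \<Sum>i\<in>I. f i y) x = (\<Sum>i\<in>I. avg (f i) x)"
  unfolding avg_def by (subst sum.swap) (simp add: sum_divide_distrib)

lemma avg_nonneg: "x \<in> torus N d \<Longrightarrow> (\<And>y. y \<in> torus N d \<Longrightarrow> 0 \<le> f y) \<Longrightarrow> 0 \<le> avg f x"
  using avg_mono[of x "\<lambda>_. 0" f] by simp

text \<open>Pairing the two signs of each direction exhibits second differences, the form in which
  cosines and squared displacements are averaged below.\<close>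

lemma avg_coord:
  "avg f x = (\<Sum>i<d. (f (x(i := (x i + 1) mod int N)) + f (x(i := (x i - 1) mod int N))) / 2) / real d"
proof -
  have "(\<Sum>s\<in>step_set d. f (torus_step N x s)) =
    (\<Sum>i<d. f (x(i := (x i + 1) mod int N)) + f (x(i := (x i - 1) mod int N)))"
    unfolding step_set_def sum.cartesian_product' torus_step_def
    by (intro sum.cong) (auto simp: add.commute)
  thus ?thesis unfolding avg_def by (simp add: sum_divide_distrib field_simps)
qed

lemma lazy_mono:
  assumes "x \<in> torus N d" "\<And>y. y \<in> torus N d \<Longrightarrow> f y \<le> g y"
  shows "lazy f x \<le> lazy g x"
  unfolding lazy_def by (intro divide_right_mono add_mono avg_mono assms) auto

lemma lazy_cong:
  assumes "x \<in> torus N d" "\<And>y. y \<in> torus N d \<Longrightarrow> f y = g y"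
  shows "lazy f x = lazy g x"
  unfolding lazy_def using assms(2)[OF assms(1)] avg_cong[OF assms] by simp

lemma lazy_const [simp]: "lazy (\<lambda>_. c) x = c"
  by (simp add: lazy_def)

lemma lazy_add: "lazy (\<lambda>y. f y + g y) x = lazy f x + lazy g x"
  by (simp add: lazy_def avg_add field_simps)

lemma lazy_cmult: "lazy (\<lambda>y. c * f y) x = c * lazy f x"
  by (simp add: lazy_def avg_cmult field_simps)

lemma lazy_sum: "lazy (\<lambda>y. \<Sum>i\<in>I. f i y) x = (\<Sum>i\<in>I. lazy (f i) x)"
  by (simp add: lazy_def avg_sum sum.distrib flip: sum_divide_distrib)

lemma lazy_iter_mono:
  assumes "x \<in> torus N d" "\<And>y. y \<in> torus N d \<Longrightarrow> f y \<le> g y"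
  shows "(lazy ^^ n) f x \<le> (lazy ^^ n) g x"
  using assms by (induction n arbitrary: x) (auto intro: lazy_mono)

lemma lazy_iter_const [simp]: "(lazy ^^ n) (\<lambda>_. c) = (\<lambda>_. c)"
  by (induction n) auto

lemma lazy_iter_sum: "(lazy ^^ n) (\<lambda>y. \<Sum>i\<in>I. f i y) = (\<lambda>x. \<Sum>i\<in>I. (lazy ^^ n) (f i) x)"
  by (induction n) (auto simp: lazy_sum)

lemma lazy_iter_indicator_nonneg: "x \<in> torus N d \<Longrightarrow> 0 \<le> (lazy ^^ n) (indicator A) x"
  using lazy_iter_mono[of x "\<lambda>_. 0" "indicator A" n] by simp

lemma lazy_iter_indicator_le_1: "x \<in> torus N d \<Longrightarrow> (lazy ^^ n) (indicator A) x \<le> 1"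
  using lazy_iter_mono[of x "indicator A" "\<lambda>_. 1" n] by (simp add: indicator_def)

lemma lazy_iter_indicator_mono:
  "x \<in> torus N d \<Longrightarrow> A \<subseteq> B \<Longrightarrow> (lazy ^^ n) (indicator A) x \<le> (lazy ^^ n) (indicator B) x"
  by (intro lazy_iter_mono) (auto simp: indicator_def)

lemma lazy_iter_indicator_sum:
  assumes "finite A"
  shows "(lazy ^^ n) (indicator A) x = (\<Sum>w\<in>A. (lazy ^^ n) (indicator {w}) x)"
proof -
  have "indicator A = (\<lambda>y. \<Sum>w\<in>A. indicator {w} y :: real)"
    using assms by (intro ext) (simp add: indicator_def)
  thus ?thesis by (simp add: lazy_iter_sum)
qed

end

section \<open>Fourier analysis of the lazy walk\<close>

text \<open>Orthogonality of the characters of the cyclic group: the sum is geometric with ratio an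
  \<open>n\<close>-th root of unity \<open>z\<close>, so it vanishes unless
  \<open>z = 1\<close>.\<close>

lemma sum_cis_geometric:
  fixes a :: int
  assumes "n > 0"
  shows "(\<Sum>k\<in>{0..<int n}. cis (2 * pi * of_int k * of_int a / real n)) = (if int n dvd a then of_nat n else 0)"
proof -
  define z where "z = cis (2 * pi * of_int a / real n)"
  have re: "(\<Sum>k\<in>{0..<int n}. cis (2 * pi * of_int k * of_int a / real n)) = (\<Sum>k<n. z ^ k)"
  proof (rule sum.reindex_bij_witness[of _ int nat])
    fix k assume "k \<in> {0..<int n}"
    hence "real (nat k) * (2 * pi * of_int a / real n) = 2 * pi * of_int k * of_int a / real n"
      by simp
    thus "z ^ nat k = cis (2 * pi * of_int k * of_int a / real n)"
      unfolding z_def Complex.DeMoivre by (rule arg_cong)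
  qed auto
  have z1: "z = 1 \<longleftrightarrow> int n dvd a"
  proof
    assume "z = 1"
    hence "cos (2 * pi * of_int a / real n) = 1" by (simp add: z_def complex_eq_iff)
    then obtain j :: int where "2 * pi * of_int a / real n = of_int j * 2 * pi"
      by (auto simp: cos_one_2pi_int)
    hence "of_int a = (of_int j * real n)" using assms by (simp add: field_simps)
    hence "a = j * int n" by (metis of_int_eq_iff of_int_mult of_int_of_nat_eq)
    thus "int n dvd a" by simp
  next
    assume "int n dvd a"
    then obtain j where "a = int n * j" by auto
    hence "2 * pi * of_int a / real n = 2 * pi * of_int j" using assms by simp
    thus "z = 1" by (simp add: z_def cis_multiple_2pi)
  qed
  have zn: "z ^ n = 1"
    unfolding z_def Complex.DeMoivre using assms by (simp add: cis_multiple_2pi)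
  show ?thesis
  proof (cases "int n dvd a")
    case True
    hence "z = 1" using z1 by simp
    thus ?thesis using True unfolding re by simp
  next
    case False
    hence "z \<noteq> 1" using z1 by simp
    thus ?thesis using False unfolding re sum_gp_strict zn by simp
  qed
qed

text \<open>Comparison with a telescoping sum: \<open>1 / (1 + s\<^sup>2 r\<^sup>2) \<le> 2 / ((1 + s (r - 1)) (1 + s r))\<close>.\<close>

lemma sum_gaussian_le:
  fixes s :: real
  assumes "s > 0"
  shows "(\<Sum>r=1..n. exp (- (s * real r)\<^sup>2)) \<le> 2 / s"
proof -
  have "(\<Sum>r=1..n. exp (- (s * real r)\<^sup>2)) \<le> 2 / s * (1 - 1 / (1 + s * real n))"
  proof (induction n)
    case (Suc n)
    define y where "y = 1 + s * real n"
    have y: "y > 0" "y + s > 0" using assms by (simp_all add: y_def add_pos_nonneg)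
    have ys: "s * real (Suc n) = y + s - 1" by (simp add: y_def algebra_simps)
    have "exp (- (y + s - 1)\<^sup>2) \<le> 1 / (1 + (y + s - 1)\<^sup>2)"
      using exp_ge_add_one_self[of "(y + s - 1)\<^sup>2"]
      by (simp add: exp_minus field_simps add_pos_nonneg)
    also have "\<dots> \<le> 2 / (y * (y + s))"
    proof -
      have "y * (y + s) \<le> (y + s) ^ 2" using y assms by (simp add: power2_eq_square mult_right_mono)
      \<comment> \<open>The right side minus the left side is
        \<open>(y + s - 2)\<^sup>2\<close>.\<close>
      also have "\<dots> \<le> 2 * (1 + (y + s - 1)\<^sup>2)"
        using zero_le_power2[of "y + s - 2"] by (simp add: power2_eq_square algebra_simps)
      finally have "2 / (2 * (1 + (y + s - 1)\<^sup>2)) \<le> 2 / (y * (y + s))"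
        using y assms by (intro divide_left_mono mult_pos_pos add_pos_nonneg) auto
      moreover have "2 / (2 * z) = 1 / z" for z :: real by simp
      ultimately show ?thesis by (simp only:)
    qed
    also have "\<dots> = 2 / s * (1 / y - 1 / (y + s))" using y assms by (simp add: field_simps)
    finally have step: "exp (- (y + s - 1)\<^sup>2) \<le> 2 / s * (1 / y - 1 / (y + s))" .
    have "1 + s * real (Suc n) = y + s" by (simp add: y_def algebra_simps)
    moreover have "(\<Sum>r=1..n. exp (- (s * real r)\<^sup>2)) \<le> 2 / s * (1 - 1 / y)"
      using Suc by (simp add: y_def)
    moreover have "(\<Sum>r=1..Suc n. exp (- (s * real r)\<^sup>2)) = (\<Sum>r=1..n. exp (- (s * real r)\<^sup>2)) + exp (- (y + s - 1)\<^sup>2)"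
      unfolding ys[symmetric] by simp
    ultimately show ?case using step by (simp only: right_diff_distrib)
  qed simp
  also have "\<dots> \<le> 2 / s" using assms by (simp add: field_simps add_pos_nonneg)
  finally show ?thesis .
qed

text \<open>Jordan's inequality: by concavity the sine lies above its chord between 0 and
  \<open>pi / 2\<close>.\<close>

lemma sin_ge_two_over_pi:
  assumes "0 \<le> x" "x \<le> pi / 2"
  shows "sin x \<ge> 2 / pi * x"
proof -
  have "concave_on {0..pi} sin"
    unfolding concave_on_def
  proof (rule f''_ge0_imp_convex)
    show "((\<lambda>x. - sin x) has_real_derivative - cos x) (at x)" for x :: real
      by (auto intro!: derivative_eq_intros)
    show "((\<lambda>x. - cos x) has_real_derivative sin x) (at x)" for x :: real
      by (auto intro!: derivative_eq_intros)
  qed (auto intro: sin_ge_zero)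
  hence "convex_on {0..pi} (\<lambda>x. - sin x)" by (simp add: concave_on_def)
  from convex_onD[OF this, of "2 / pi * x" 0 "pi / 2"] assms
  show ?thesis by (simp add: field_simps)
qed

text \<open>The angles \<open>pi * k / n\<close> and \<open>pi * (n - k) / n\<close> have the same
  sine, and Jordan's inequality applies to the smaller one.\<close>

lemma sin_sq_ge:
  assumes "0 \<le> k" "k \<le> n" "n > 0"
  shows "(2 * (min k (n - k)) / n)\<^sup>2 \<le> (sin (pi * k / n))\<^sup>2"
proof -
  have half: "(2 * j / n)\<^sup>2 \<le> (sin (pi * j / n))\<^sup>2" if "0 \<le> j" "2 * j \<le> n" for j :: real
  proof (rule power_mono)
    have "pi * j / n \<le> pi / 2" using that assms by (simp add: field_simps)
    from sin_ge_two_over_pi[OF _ this] that assms show "2 * j / n \<le> sin (pi * j / n)" by simp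
  qed (use that assms in auto)
  have "sin (pi * k / n) = sin (pi - pi * k / n)" by simp
  also have "pi - pi * k / n = pi * (n - k) / n" using assms by (simp add: field_simps)
  finally have sym: "sin (pi * k / n) = sin (pi * (n - k) / n)" .
  show ?thesis
  proof (cases "2 * k \<le> n")
    case True
    thus ?thesis using half[of k] assms by (simp add: min_def)
  next
    case False
    thus ?thesis using half[of "n - k"] assms sym by (simp add: min_def)
  qed
qed

text \<open>Each frequency is compared with a Gaussian centered at the nearer of the ends 0 and
  \<open>n\<close>. The frequency 0 contributes 1, and the two Gaussian sums at most
  \<open>2 / s\<close> each, with \<open>s = 2 * sqrt a / n\<close>.\<close>

lemma sum_exp_sin_sq_le:
  assumes "n > 0" "a > 0"
  shows "(\<Sum>k\<in>{0..<int n}. exp (- a * (sin (pi * of_int k / real n))\<^sup>2)) \<le> 2 + 2 * real n / sqrt a"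
proof -
  define s where "s = 2 * sqrt a / real n"
  have s: "s > 0" using assms by (simp add: s_def)
  define g where "g r = exp (- (s * real r)\<^sup>2)" for r :: nat
  have le: "exp (- a * (sin (pi * of_int (int k) / real n))\<^sup>2) \<le> g k + g (n - k)" if "k < n" for k
  proof -
    have "(s * min (real k) (real (n - k)))\<^sup>2 = a * (2 * min (real k) (real n - real k) / real n)\<^sup>2"
      using that assms by (simp add: s_def power_mult_distrib power_divide of_nat_diff)
    also have "\<dots> \<le> a * (sin (pi * real k / real n))\<^sup>2"
      using assms that by (intro mult_left_mono sin_sq_ge) auto
    finally have "exp (- a * (sin (pi * real k / real n))\<^sup>2) \<le> exp (- (s * min (real k) (real (n - k)))\<^sup>2)"
      by simp
    also have "\<dots> \<le> g k + g (n - k)"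
      by (auto simp: g_def min_def add_increasing add_increasing2)
    finally show ?thesis by simp
  qed
  have "(\<Sum>k\<in>{0..<int n}. exp (- a * (sin (pi * of_int k / real n))\<^sup>2))
      = (\<Sum>k<n. exp (- a * (sin (pi * of_int (int k) / real n))\<^sup>2))"
    by (rule sum.reindex_bij_witness[of _ int nat]) auto
  also have "\<dots> \<le> (\<Sum>k<n. g k + g (n - k))" by (intro sum_mono le) simp
  also have "\<dots> = (\<Sum>k<n. g k) + (\<Sum>k<n. g (n - k))" by (rule sum.distrib)
  also have "(\<Sum>k<n. g (n - k)) = (\<Sum>k=1..n. g k)"
    by (rule sum.reindex_bij_witness[of _ "\<lambda>k. n - k" "\<lambda>k. n - k"]) auto
  also have "(\<Sum>k<n. g k) \<le> (\<Sum>k\<in>insert 0 {1..n}. g k)"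
    by (rule sum_mono2) (auto simp: g_def)
  also have "\<dots> = 1 + (\<Sum>k=1..n. g k)" by (simp add: g_def)
  also have "(\<Sum>k=1..n. g k) \<le> 2 / s" unfolding g_def by (rule sum_gaussian_le[OF s])
  finally have "(\<Sum>k\<in>{0..<int n}. exp (- a * (sin (pi * of_int k / real n))\<^sup>2)) \<le> 1 + 2 / s + 2 / s"
    by simp
  also have "1 + 2 / s + 2 / s \<le> 2 + 2 * real n / sqrt a"
    using assms by (simp add: s_def)
  finally show ?thesis .
qed

section \<open>Spectral bounds for the kernel of the lazy walk\<close>

context torus_walk begin

text \<open>\<open>eig k\<close> is \<open>(1 + (1/d) \<Sum>\<^sub>i cos (2 \<pi> k\<^sub>i / N)) / 2\<close>, rewritten by \<open>1 - cos (2 a) = 2 sin\<^sup>2 a\<close>.\<close>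

definition eig :: "(nat \<Rightarrow> int) \<Rightarrow> real" where
  "eig k = 1 - (\<Sum>i<d. (sin (pi * of_int (k i) / real N))\<^sup>2) / real d"

text \<open>\<open>cis (phase w k x)\<close> is the character of frequency \<open>k\<close> at the
  displacement \<open>x - w\<close>.\<close>

definition phase :: "(nat \<Rightarrow> int) \<Rightarrow> (nat \<Rightarrow> int) \<Rightarrow> (nat \<Rightarrow> int) \<Rightarrow> real" where
  "phase w k x = 2 * pi * (\<Sum>i<d. of_int (k i) * of_int (x i - w i)) / real N"

text \<open>Laziness pays off here: a nonnegative \<open>eig k ^ n\<close> can be multiplied with
  the bounds -1 and 1 of a cosine, whatever the parity of \<open>n\<close>.\<close>

lemma eig_nonneg: "0 \<le> eig k"
proof -
  have "(\<Sum>i<d. (sin (pi * of_int (k i) / real N))\<^sup>2) \<le> (\<Sum>i<d. 1)"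
    by (intro sum_mono) (simp add: abs_square_le_1)
  thus ?thesis using d_pos by (simp add: eig_def)
qed

lemma eig_le_exp: "eig k \<le> exp (- (\<Sum>i<d. (sin (pi * of_int (k i) / real N))\<^sup>2) / real d)"
  using exp_ge_add_one_self[of "- (\<Sum>i<d. (sin (pi * of_int (k i) / real N))\<^sup>2) / real d"]
  by (simp add: eig_def)

text \<open>Reduction modulo \<open>N\<close> changes the phase by an integer multiple of
  \<open>2 * pi\<close> only.\<close>

lemma cos_phase_shift:
  assumes "i < d"
  shows "cos (phase w k (x(i := (x i + t) mod int N))) = cos (phase w k x + 2 * pi * of_int (k i) * of_int t / real N)"
proof -
  define q where "q = (x i + t) div int N"
  have e: "(x i + t) mod int N = x i + t - int N * q" by (simp add: q_def minus_mult_div_eq_mod)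
  have "(\<Sum>j<d. of_int (k j) * of_int ((x(i := (x i + t) mod int N)) j - w j) :: real)
     = (\<Sum>j<d. of_int (k j) * of_int (x j - w j) + (if j = i then of_int (k i) * (of_int t - real N * of_int q) else 0))"
    by (rule sum.cong[OF refl]) (simp add: e, simp add: algebra_simps)
  also have "\<dots> = (\<Sum>j<d. of_int (k j) * of_int (x j - w j)) + of_int (k i) * (of_int t - real N * of_int q)"
    using assms by (simp add: sum.distrib)
  finally have S: "(\<Sum>j<d. of_int (k j) * of_int ((x(i := (x i + t) mod int N)) j - w j) :: real) = \<dots>" .
  have "phase w k (x(i := (x i + t) mod int N)) =
      phase w k x + 2 * pi * of_int (k i) * (of_int t - real N * of_int q) / real N"
    unfolding phase_def S by (simp only: distrib_left add_divide_distrib mult.assoc)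
  also have "2 * pi * of_int (k i) * (of_int t - real N * of_int q) / real N
      = 2 * pi * of_int (k i) * of_int t / real N + 2 * pi * of_int (- k i * q)"
    using N_pos by (simp add: field_simps)
  finally have "phase w k (x(i := (x i + t) mod int N)) =
      phase w k x + 2 * pi * of_int (k i) * of_int t / real N + 2 * pi * of_int (- k i * q)"
    by (simp only: add.assoc)
  thus ?thesis by (simp only: cos_add[of "_ + _" "2 * pi * of_int _"] cos_int_2pin sin_int_2pin)
qed

text \<open>The two neighbors in direction \<open>i\<close> shift the phase by opposite amounts, and
  \<open>cos (a + b) + cos (a - b) = 2 * cos a * cos b\<close>. Hence \<open>avg\<close> multiplies
  the cosine by \<open>2 * eig k - 1\<close>, and \<open>lazy\<close> by
  \<open>eig k\<close>.\<close>

lemma lazy_cos_phase: "lazy (\<lambda>x. cos (phase w k x)) x = eig k * cos (phase w k x)"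
proof -
  have "(\<Sum>i<d. (cos (phase w k (x(i := (x i + 1) mod int N))) + cos (phase w k (x(i := (x i - 1) mod int N)))) / 2)
    = (\<Sum>i<d. cos (phase w k x) * (1 - 2 * (sin (pi * of_int (k i) / real N))\<^sup>2))"
  proof (rule sum.cong[OF refl])
    fix i assume i: "i \<in> {..<d}"
    define a where "a = pi * of_int (k i) / real N"
    have "cos (phase w k (x(i := (x i + 1) mod int N))) = cos (phase w k x + 2 * a)"
      using cos_phase_shift[of i w k x 1] i by (simp add: a_def mult_ac)
    moreover have "cos (phase w k (x(i := (x i - 1) mod int N))) = cos (phase w k x - 2 * a)"
      using cos_phase_shift[of i w k x "-1"] i by (simp add: a_def mult_ac)
    ultimately show "(cos (phase w k (x(i := (x i + 1) mod int N))) + cos (phase w k (x(i := (x i - 1) mod int N)))) / 2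
      = cos (phase w k x) * (1 - 2 * (sin (pi * of_int (k i) / real N))\<^sup>2)"
      unfolding a_def[symmetric] by (simp add: cos_add cos_diff cos_double_sin)
  qed
  hence "avg (\<lambda>x. cos (phase w k x)) x
      = cos (phase w k x) * (\<Sum>i<d. 1 - 2 * (sin (pi * of_int (k i) / real N))\<^sup>2) / real d"
    unfolding avg_coord by (simp add: sum_distrib_left)
  also have "\<dots> = cos (phase w k x) * (2 * eig k - 1)"
    using d_pos by (simp add: eig_def sum_subtractf field_simps flip: sum_distrib_left)
  finally show ?thesis by (simp add: lazy_def algebra_simps)
qed

text \<open>The sum of all characters factorizes over the coordinates; by orthogonality a factor
  vanishes as soon as \<open>x\<close> and \<open>w\<close> differ there. Taking real parts leaves
  the cosines.\<close>

lemma indicator_fourier: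
  assumes "x \<in> torus N d" "w \<in> torus N d"
  shows "indicator {w} x = (\<Sum>k\<in>torus N d. cos (phase w k x)) / real N ^ d"
proof -
  have cis_sum: "finite A \<Longrightarrow> cis (\<Sum>i\<in>A. f i) = (\<Prod>i\<in>A. cis (f i))" for A :: "nat set" and f
    by (induction A rule: finite_induct) (auto simp: cis_mult[symmetric])
  have "(\<Sum>k\<in>torus N d. cis (phase w k x))
     = (\<Sum>k\<in>torus N d. \<Prod>i<d. cis (2 * pi * of_int (k i) * of_int (x i - w i) / real N))"
    by (simp add: phase_def sum_distrib_left sum_divide_distrib cis_sum mult.assoc)
  also have "\<dots> = (\<Prod>i<d. \<Sum>j\<in>{0..<int N}. cis (2 * pi * of_int j * of_int (x i - w i) / real N))"
    unfolding torus_def by (rule prod_sum_PiE[symmetric]) auto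
  also have "\<dots> = (\<Prod>i<d. if int N dvd x i - w i then of_nat N else 0)"
    by (intro prod.cong refl sum_cis_geometric N_pos)
  also have "\<dots> = (if x = w then of_nat N ^ d else 0)"
  proof (cases "x = w")
    case False
    then obtain i where i: "i < d" "x i \<noteq> w i"
      using assms by (auto simp: torus_def dest: PiE_ext)
    have "\<not> int N dvd x i - w i"
    proof
      assume "int N dvd x i - w i"
      moreover have "x i \<in> {0..<int N}" "w i \<in> {0..<int N}"
        using assms i by (auto simp: torus_def PiE_iff)
      ultimately show False using i(2) by (auto simp: mod_eq_dvd_iff[symmetric])
    qed
    thus ?thesis using False i(1) by (auto intro!: bexI[of _ i])
  qed simp
  finally have "Re (\<Sum>k\<in>torus N d. cis (phase w k x)) = Re (if x = w then of_nat N ^ d else 0)"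
    by simp
  hence "(\<Sum>k\<in>torus N d. cos (phase w k x)) = (if x = w then real N ^ d else 0)"
    by (simp split: if_splits flip: of_nat_power)
  thus ?thesis using N_pos by simp
qed

lemma lazy_iter_fourier:
  assumes "x \<in> torus N d" "w \<in> torus N d"
  shows "(lazy ^^ n) (indicator {w}) x = (\<Sum>k\<in>torus N d. eig k ^ n * cos (phase w k x)) / real N ^ d"
  using assms(1)
proof (induction n arbitrary: x)
  case 0
  thus ?case using indicator_fourier[OF _ assms(2)] by simp
next
  case (Suc n)
  have "(lazy ^^ Suc n) (indicator {w}) x = lazy ((lazy ^^ n) (indicator {w})) x" by simp
  also have "\<dots> = lazy (\<lambda>x. (1 / real N ^ d) * (\<Sum>k\<in>torus N d. eig k ^ n * cos (phase w k x))) x"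
    by (rule lazy_cong[OF Suc.prems]) (simp add: Suc.IH)
  also have "\<dots> = (\<Sum>k\<in>torus N d. eig k ^ n * (eig k * cos (phase w k x))) / real N ^ d"
    by (simp only: lazy_cmult lazy_sum lazy_cos_phase) simp
  finally show ?case by (simp add: mult_ac)
qed

text \<open>Bounding the cosines by 1 and each eigenvalue by an exponential makes the spectral sum a
  product of \<open>d\<close> equal one-dimensional sums, to which \<open>sum_exp_sin_sq_le\<close>
  applies with \<open>a = n / d\<close>.\<close>

lemma lazy_kernel_le:
  assumes "x \<in> torus N d" "w \<in> torus N d" "n > 0"
  shows "(lazy ^^ n) (indicator {w}) x \<le> (2 / real N + 2 * sqrt (real d) / sqrt (real n)) ^ d"
proof -
  have "(\<Sum>k\<in>torus N d. eig k ^ n * cos (phase w k x))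
     \<le> (\<Sum>k\<in>torus N d. \<Prod>i<d. exp (- (real n / real d) * (sin (pi * of_int (k i) / real N))\<^sup>2))"
  proof (rule sum_mono)
    fix k
    have "eig k ^ n * cos (phase w k x) \<le> eig k ^ n * 1"
      by (intro mult_left_mono) (auto simp: eig_nonneg)
    also have "\<dots> \<le> exp (- (\<Sum>i<d. (sin (pi * of_int (k i) / real N))\<^sup>2) / real d) ^ n"
      by (simp only: mult_1_right) (intro power_mono eig_le_exp eig_nonneg)
    also have "\<dots> = exp (\<Sum>i<d. - (real n / real d) * (sin (pi * of_int (k i) / real N))\<^sup>2)"
      by (simp add: exp_of_nat_mult[symmetric] sum_distrib_left sum_divide_distrib sum_negf)
    also have "\<dots> = (\<Prod>i<d. exp (- (real n / real d) * (sin (pi * of_int (k i) / real N))\<^sup>2))"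
      by (simp add: exp_sum)
    finally show "eig k ^ n * cos (phase w k x) \<le> \<dots>" .
  qed
  also have "\<dots> = (\<Prod>i<d. \<Sum>j\<in>{0..<int N}. exp (- (real n / real d) * (sin (pi * of_int j / real N))\<^sup>2))"
    unfolding torus_def by (rule prod_sum_PiE[symmetric]) auto
  also have "\<dots> = (\<Sum>j\<in>{0..<int N}. exp (- (real n / real d) * (sin (pi * of_int j / real N))\<^sup>2)) ^ d"
    by simp
  also have "\<dots> \<le> (2 + 2 * real N / sqrt (real n / real d)) ^ d"
    using assms(3) d_pos N_pos by (intro power_mono sum_exp_sin_sq_le sum_nonneg) auto
  finally have "(lazy ^^ n) (indicator {w}) x \<le> (2 + 2 * real N / sqrt (real n / real d)) ^ d / real N ^ d"
    unfolding lazy_iter_fourier[OF assms(1,2)] by (intro divide_right_mono) auto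
  also have "\<dots> = (2 / real N + 2 * sqrt (real d) / sqrt (real n)) ^ d"
    using N_pos assms(3) d_pos by (simp flip: power_divide add: add_divide_distrib real_sqrt_divide)
  finally show ?thesis .
qed

lemma card_torus: "card (torus N d) = N ^ d"
  by (simp add: torus_def card_PiE)

text \<open>The zero frequency contributes exactly 1 to the spectral sum. For any other frequency
  some \<open>sin\<^sup>2\<close> is at least \<open>(2 / N)\<^sup>2\<close>, and \<open>mix\<close>
  keeps the total of these at most \<open>N ^ d\<close> terms above \<open>- 1 / 2\<close>.\<close>

lemma lazy_kernel_ge:
  assumes "x \<in> torus N d" "w \<in> torus N d"
    and mix: "real N ^ d * exp (- 4 * real n / (real d * real N ^ 2)) \<le> 1 / 2"
  shows "1 / (2 * real N ^ d) \<le> (lazy ^^ n) (indicator {w}) x"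
proof -
  define z where "z = (\<lambda>i\<in>{..<d}. 0 :: int)"
  have z: "z \<in> torus N d" using N_pos by (auto simp: z_def torus_def)
  have zeig: "eig z = 1" "phase w z x = 0" by (simp_all add: z_def eig_def phase_def)
  have small: "- exp (- 4 * real n / (real d * real N ^ 2)) \<le> eig k ^ n * cos (phase w k x)"
    if k: "k \<in> torus N d - {z}" for k
  proof -
    obtain i where i: "i < d" "k i \<noteq> 0"
    proof -
      have "\<exists>i<d. k i \<noteq> z i" using k z by (auto simp: torus_def dest: PiE_ext)
      thus ?thesis using that by (auto simp: z_def)
    qed
    have "0 \<le> k i" "k i < int N" using k i by (auto simp: torus_def PiE_iff)
    hence ki: "1 \<le> k i" "k i \<le> int N - 1" using i by auto
    have "(2 / real N)\<^sup>2 \<le> (2 * min (of_int (k i)) (real N - of_int (k i)) / real N)\<^sup>2"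
      using ki N_pos by (intro power_mono divide_right_mono) auto
    also have "\<dots> \<le> (sin (pi * of_int (k i) / real N))\<^sup>2"
      using ki N_pos by (intro sin_sq_ge) auto
    also have "\<dots> \<le> (\<Sum>i<d. (sin (pi * of_int (k i) / real N))\<^sup>2)"
      using i by (intro member_le_sum) auto
    finally have "eig k \<le> exp (- ((2 / real N)\<^sup>2) / real d)"
      by (intro order_trans[OF eig_le_exp]) (simp add: divide_right_mono)
    hence "eig k ^ n \<le> exp (- ((2 / real N)\<^sup>2) / real d) ^ n"
      by (intro power_mono eig_nonneg)
    also have "\<dots> = exp (- 4 * real n / (real d * real N ^ 2))"
      by (simp add: exp_of_nat_mult[symmetric] power_divide mult_ac)
    finally have e: "eig k ^ n \<le> exp (- 4 * real n / (real d * real N ^ 2))" .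
    have "eig k ^ n * (- 1) \<le> eig k ^ n * cos (phase w k x)"
      by (intro mult_left_mono) (auto simp: eig_nonneg)
    thus ?thesis using e by linarith
  qed
  have "1 / 2 \<le> 1 + (\<Sum>k\<in>torus N d - {z}. - exp (- 4 * real n / (real d * real N ^ 2)))"
  proof -
    have "real (card (torus N d - {z})) \<le> real N ^ d"
      using card_Diff1_le[of "torus N d" z] unfolding card_torus by (simp flip: of_nat_power)
    hence "real (card (torus N d - {z})) * exp (- 4 * real n / (real d * real N ^ 2)) \<le> 1 / 2"
      by (intro order_trans[OF mult_right_mono mix]) auto
    thus ?thesis by simp
  qed
  also have "\<dots> \<le> eig z ^ n * cos (phase w z x) + (\<Sum>k\<in>torus N d - {z}. eig k ^ n * cos (phase w k x))"
    by (intro add_mono sum_mono small) (auto simp: zeig)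
  also have "\<dots> = (\<Sum>k\<in>torus N d. eig k ^ n * cos (phase w k x))"
    using z by (subst sum.remove[OF finite_torus z]) auto
  finally have "(1 / 2) / real N ^ d \<le> (lazy ^^ n) (indicator {w}) x"
    unfolding lazy_iter_fourier[OF assms(1,2)] by (intro divide_right_mono) auto
  thus ?thesis by simp
qed

end

section \<open>Discounted cover times and Matthews' bound\<close>

context torus_walk begin

text \<open>
  Let \<open>C\<close> be the first time at which the walk has visited \<open>T j\<close> for all \<open>j \<in> J\<close>. Then \<open>cover p T n J x\<close> is
  \<open>E\<^sub>x[p\<^sup>C; C \<le> n]\<close>, a probability if \<open>p = 1\<close>, and \<open>cover_but p T j n J x\<close> is the part of this expectation
  on the event that \<open>T j\<close> has not been visited by time \<open>C\<close>.
\<close>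

primrec cover :: "real \<Rightarrow> ('j \<Rightarrow> (nat \<Rightarrow> int) set) \<Rightarrow> nat \<Rightarrow> 'j set \<Rightarrow> (nat \<Rightarrow> int) \<Rightarrow> real" where
  "cover p T 0 J x = (if \<forall>j\<in>J. x \<in> T j then 1 else 0)"
| "cover p T (Suc n) J x = (if \<forall>j\<in>J. x \<in> T j then 1 else p * avg (cover p T n {j\<in>J. x \<notin> T j}) x)"

primrec cover_but :: "real \<Rightarrow> ('j \<Rightarrow> (nat \<Rightarrow> int) set) \<Rightarrow> 'j \<Rightarrow> nat \<Rightarrow> 'j set \<Rightarrow> (nat \<Rightarrow> int) \<Rightarrow> real" where
  "cover_but p T j 0 J x = (if x \<notin> T j \<and> (\<forall>i\<in>J. x \<in> T i) then 1 else 0)"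
| "cover_but p T j (Suc n) J x = (if x \<in> T j then 0 else if \<forall>i\<in>J. x \<in> T i then 1
     else p * avg (cover_but p T j n {i\<in>J. x \<notin> T i}) x)"

lemma cover_empty [simp]: "cover p T n {} x = 1"
  by (cases n) auto

lemma cover_bounds:
  assumes "0 \<le> p" "p \<le> 1" "x \<in> torus N d"
  shows "0 \<le> cover p T n J x \<and> cover p T n J x \<le> 1"
  using assms(3)
proof (induction n arbitrary: J x)
  case (Suc n)
  have "0 \<le> avg (cover p T n {j\<in>J. x \<notin> T j}) x" "avg (cover p T n {j\<in>J. x \<notin> T j}) x \<le> 1"
    using avg_nonneg[OF Suc.prems] avg_mono[OF Suc.prems, of _ "\<lambda>_. 1"] Suc.IH by auto
  thus ?case using assms by (auto intro: mult_le_one)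
qed auto

text \<open>On the event that the cover time is at most \<open>n\<close>, the discount is at least
  \<open>p ^ n\<close>.\<close>

lemma cover_discount:
  assumes "0 \<le> p" "p \<le> 1" "x \<in> torus N d"
  shows "p ^ n * cover 1 T n J x \<le> cover p T n J x"
  using assms(3)
proof (induction n arbitrary: J x)
  case (Suc n)
  have "p ^ n * avg (cover 1 T n {j\<in>J. x \<notin> T j}) x \<le> avg (cover p T n {j\<in>J. x \<notin> T j}) x"
    unfolding avg_cmult[symmetric] by (rule avg_mono[OF Suc.prems]) (rule Suc.IH)
  hence "p * (p ^ n * avg (cover 1 T n {j\<in>J. x \<notin> T j}) x) \<le> p * avg (cover p T n {j\<in>J. x \<notin> T j}) x"
    using assms by (intro mult_left_mono)
  thus ?case using assms by (auto simp: mult_ac power_le_one mult_le_one)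
qed auto

text \<open>Maximum principle: discounted by \<open>p\<close>, the value of \<open>f\<close> along
  the walk does not increase in mean, so \<open>f x\<close> bounds its discounted mean at the
  hitting time of \<open>T j\<close>, where \<open>f\<close> is at least \<open>c\<close>.\<close>

lemma cover_single_le:
  assumes "0 \<le> p" "0 \<le> c" "x \<in> torus N d"
    and f0: "\<And>y. y \<in> torus N d \<Longrightarrow> 0 \<le> f y"
    and sup: "\<And>y. y \<in> torus N d \<Longrightarrow> p * avg f y \<le> f y"
    and fc: "\<And>y. y \<in> torus N d \<Longrightarrow> y \<in> T j \<Longrightarrow> c \<le> f y"
  shows "c * cover p T n {j} x \<le> f x"
  using assms(3)
proof (induction n arbitrary: x)
  case 0
  thus ?case using f0 fc by auto
next
  case (Suc n)
  show ?case
  proof (cases "x \<in> T j")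
    case False
    have "{i \<in> {j}. x \<notin> T i} = {j}" using False by auto
    hence "c * cover p T (Suc n) {j} x = p * avg (\<lambda>y. c * cover p T n {j} y) x"
      using False by (simp add: avg_cmult mult_ac)
    also have "\<dots> \<le> p * avg f x" by (intro mult_left_mono avg_mono Suc assms)
    also have "\<dots> \<le> f x" by (rule sup[OF Suc.prems])
    finally show ?thesis .
  qed (use fc Suc in auto)
qed

lemma cover_Suc_step:
  "{j\<in>J. x \<notin> T j} = J' \<Longrightarrow> J' \<noteq> {} \<Longrightarrow> cover p T (Suc n) J x = p * avg (cover p T n J') x"
  by auto

lemma cover_but_Suc_step:
  "x \<notin> T j \<Longrightarrow> {i\<in>J. x \<notin> T i} = J' \<Longrightarrow> J' \<noteq> {} \<Longrightarrow>
    cover_but p T j (Suc n) J x = p * avg (cover_but p T j n J') x"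
  by auto

lemma cover_all: "\<forall>j\<in>J. x \<in> T j \<Longrightarrow> cover p T n J x = 1"
  by (cases n) auto

lemma cover_but_all: "x \<notin> T j \<Longrightarrow> \<forall>j\<in>J. x \<in> T j \<Longrightarrow> cover_but p T j n J x = 1"
  by (cases n) auto

lemma cover_but_hit: "x \<in> T j \<Longrightarrow> cover_but p T j n J x = 0"
  by (cases n) auto

section \<open>Matthews' argument for pairwise disjoint targets\<close>

context
  fixes T :: "'j \<Rightarrow> (nat \<Rightarrow> int) set"
  assumes disj: "\<And>i j. i \<noteq> j \<Longrightarrow> T i \<inter> T j = {}"
begin

text \<open>Strong Markov property at the cover time of \<open>J\<close>. If \<open>T j\<close> has
  been visited by then, adding \<open>j\<close> changes nothing; otherwise the walk stands on some
  other target, as \<open>J\<close> is nonempty, and by \<open>half\<close> reaching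
  \<open>T j\<close> costs a further factor of at most 1/2.\<close>

lemma cover_insert_le:
  assumes p: "0 \<le> p"
    and half: "\<And>n i j x. x \<in> torus N d \<Longrightarrow> i \<in> A \<Longrightarrow> j \<in> A \<Longrightarrow> i \<noteq> j \<Longrightarrow> x \<in> T i \<Longrightarrow> cover p T n {j} x \<le> 1 / 2"
    and "x \<in> torus N d" "j \<in> A" "J \<subseteq> A" "j \<notin> J" "J \<noteq> {}"
  shows "cover p T n (insert j J) x + cover_but p T j n J x / 2 \<le> cover p T n J x"
  using assms(3-)
proof (induction n arbitrary: J x)
  case 0
  thus ?case by auto
next
  case (Suc n)
  define J' where "J' = {i\<in>J. x \<notin> T i}"
  show ?case
  proof (cases "x \<in> T j")
    case True
    hence "x \<notin> T i" if "i \<in> J" for i using disj[of i j] that Suc.prems(4) by auto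
    hence "{i\<in>J. x \<notin> T i} = J" "{i \<in> insert j J. x \<notin> T i} = J" using True by auto
    thus ?thesis using Suc.prems(5) True by (simp add: cover_Suc_step cover_but_hit del: cover.simps)
  next
    case False
    hence ins: "{i \<in> insert j J. x \<notin> T i} = insert j J'" and single: "{i \<in> {j}. x \<notin> T i} = {j}"
      by (auto simp: J'_def)
    show ?thesis
    proof (cases "J' = {}")
      case True
      hence all: "\<forall>i\<in>J. x \<in> T i" by (auto simp: J'_def)
      then obtain i where i: "i \<in> J" "x \<in> T i" using Suc.prems by auto
      have "i \<in> A" "i \<noteq> j" using i Suc.prems by auto
      hence "cover p T (Suc n) {j} x \<le> 1 / 2" using half[of x i j "Suc n"] i Suc.prems by blast
      moreover have "cover p T (Suc n) (insert j J) x = cover p T (Suc n) {j} x"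
        using cover_Suc_step[OF ins] cover_Suc_step[OF single] True by simp
      ultimately show ?thesis using cover_all[of J x T p "Suc n", OF all] cover_but_all[of x T j J p "Suc n", OF False all]
        by linarith
    next
      case ne: False
      have "avg (\<lambda>y. cover p T n (insert j J') y + 1 / 2 * cover_but p T j n J' y) x \<le> avg (cover p T n J') x"
      proof (rule avg_mono)
        show "cover p T n (insert j J') y + 1 / 2 * cover_but p T j n J' y \<le> cover p T n J' y"
          if "y \<in> torus N d" for y
          using Suc.IH[OF that Suc.prems(2), of J'] Suc.prems ne by (auto simp: J'_def)
      qed (rule Suc.prems)
      hence "p * (avg (cover p T n (insert j J')) x + 1 / 2 * avg (cover_but p T j n J') x) \<le> p * avg (cover p T n J') x"
        unfolding avg_add avg_cmult using p by (intro mult_left_mono)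
      moreover have "cover p T (Suc n) (insert j J) x = p * avg (cover p T n (insert j J')) x"
        by (rule cover_Suc_step[OF ins]) simp
      moreover have "cover p T (Suc n) J x = p * avg (cover p T n J') x"
        by (rule cover_Suc_step[OF J'_def[symmetric] ne])
      moreover have "cover_but p T j (Suc n) J x = p * avg (cover_but p T j n J') x"
        by (rule cover_but_Suc_step[OF False J'_def[symmetric] ne])
      ultimately show ?thesis by (simp only: distrib_left)
    qed
  qed
qed

text \<open>
  For disjoint targets, omitting \<open>j\<close> changes the cover time only if \<open>T j\<close> is visited last, and exactly
  one target is.
\<close>

lemma sum_cover_remove:
  assumes "x \<in> torus N d" "finite A" "card A \<ge> 2"
  shows "(\<Sum>j\<in>A. cover p T n (A - {j}) x) =
    (real (card A) - 1) * cover p T n A x + (\<Sum>j\<in>A. cover_but p T j n (A - {j}) x)"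
  using assms
proof (induction n arbitrary: A x)
  case 0
  have two: "\<exists>i\<in>A. i \<noteq> j" for j
    using card_mono[of "{j}" A] 0 by fastforce
  have nc: "\<not> (\<forall>i\<in>A. x \<in> T i)"
  proof
    assume *: "\<forall>i\<in>A. x \<in> T i"
    obtain i where "i \<in> A" using two by blast
    moreover obtain j where "j \<in> A" "j \<noteq> i" using two by blast
    ultimately show False using * disj[of i j] by auto
  qed
  have "cover p T 0 (A - {j}) x = cover_but p T j 0 (A - {j}) x" if "j \<in> A" for j
    using nc that by auto
  hence "(\<Sum>j\<in>A. cover p T 0 (A - {j}) x) = (\<Sum>j\<in>A. cover_but p T j 0 (A - {j}) x)"
    by (rule sum.cong[OF refl])
  thus ?case using nc by (simp only: cover.simps if_False mult_zero_right add_0)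
next
  case (Suc n)
  have step: "(\<Sum>j\<in>B. p * avg (cover p T n (B - {j})) x) =
      (real (card B) - 1) * (p * avg (cover p T n B) x) + (\<Sum>j\<in>B. p * avg (cover_but p T j n (B - {j})) x)"
    if B: "finite B" "card B \<ge> 2" for B
  proof -
    have "(\<Sum>j\<in>B. p * avg (cover p T n (B - {j})) x) = p * avg (\<lambda>y. \<Sum>j\<in>B. cover p T n (B - {j}) y) x"
      by (simp add: avg_sum sum_distrib_left)
    also have "avg (\<lambda>y. \<Sum>j\<in>B. cover p T n (B - {j}) y) x =
       avg (\<lambda>y. (real (card B) - 1) * cover p T n B y + (\<Sum>j\<in>B. cover_but p T j n (B - {j}) y)) x"
      by (rule avg_cong[OF Suc.prems(1)]) (rule Suc.IH[OF _ B])
    finally show ?thesis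
      by (simp only: avg_add avg_cmult avg_sum sum_distrib_left distrib_left mult.left_commute)
  qed
  have two: "A - {j} \<noteq> {}" for j
    using card_mono[of "{j}" A] Suc by fastforce
  show ?case
  proof (cases "\<exists>i\<in>A. x \<in> T i")
    case False
    have r: "{i \<in> A - {j}. x \<notin> T i} = A - {j}" "{i \<in> A. x \<notin> T i} = A" for j using False by auto
    have "A \<noteq> {}" using two by blast
    note cA = cover_Suc_step[OF r(2) this]
    note cAj = cover_Suc_step[OF r(1) two]
    have cb: "cover_but p T j (Suc n) (A - {j}) x = p * avg (cover_but p T j n (A - {j})) x" if "j \<in> A" for j
      using False that by (intro cover_but_Suc_step[OF _ r(1) two]) auto
    show ?thesis
      using step[OF Suc.prems(2,3)] by (simp only: cA cAj cb cong: sum.cong)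
  next
    case True
    then obtain i where i: "i \<in> A" "x \<in> T i" by blast
    \<comment> \<open>By disjointness the walk stands on this one target only, so \<open>B\<close>
      is the set of targets left.\<close>
    define B where "B = A - {i}"
    have notin: "x \<notin> T j" if "j \<noteq> i" for j using disj[of i j] i that by auto
    have cB: "card A = Suc (card B)" using card.remove[OF Suc.prems(2) i(1)] by (simp add: B_def)
    have fB: "finite B" using Suc.prems by (simp add: B_def)
    have A: "A = insert i B" "i \<notin> B" using i by (auto simp: B_def)
    have Bne: "B \<noteq> {}" using two[of i] by (simp add: B_def)
    have r: "{j \<in> A. x \<notin> T j} = B" "{j \<in> B. x \<notin> T j} = B" using notin i by (auto simp: B_def)
    have cA: "cover p T (Suc n) A x = p * avg (cover p T n B) x"
      and ci: "cover p T (Suc n) B x = p * avg (cover p T n B) x"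
      using cover_Suc_step[OF r(1) Bne] cover_Suc_step[OF r(2) Bne] by auto
    have rest: "(\<Sum>j\<in>B. cover p T (Suc n) (A - {j}) x) =
      (real (card B) - 1) * (p * avg (cover p T n B) x) + (\<Sum>j\<in>B. cover_but p T j (Suc n) (A - {j}) x)"
    \<comment> \<open>The induction hypothesis asks for two targets. If only one is left,
      \<open>A - {j}\<close> is the single target on which the walk stands, and both sides equal
      1.\<close>
    proof (cases "card B = 1")
      case True
      then obtain j where j: "B = {j}" by (auto simp: card_1_singleton_iff)
      hence Aj: "A - {j} = {i}" "x \<notin> T j" using A notin[of j] by auto
      have "\<forall>j\<in>{i}. x \<in> T j" using i by auto
      from cover_all[where T = T, OF this] cover_but_all[where T = T, OF Aj(2) this]
      show ?thesis by (simp add: j Aj(1) del: cover.simps cover_but.simps)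
    next
      case False
      moreover have "card B \<noteq> 0" using Bne fB by simp
      ultimately have B2: "card B \<ge> 2" by linarith
      have nej: "B - {j} \<noteq> {}" for j
        using card_mono[of "{j}" B] B2 by fastforce
      have rj: "{k \<in> A - {j}. x \<notin> T k} = B - {j}" for j using r by auto
      note c = cover_Suc_step[OF rj nej]
      have cb: "cover_but p T j (Suc n) (A - {j}) x = p * avg (cover_but p T j n (B - {j})) x" if "j \<in> B" for j
        using notin[of j] that A by (intro cover_but_Suc_step[OF _ rj nej]) auto
      show ?thesis using step[OF fB B2] by (simp only: c cb cong: sum.cong)
    qed
    have "(\<Sum>j\<in>A. cover p T (Suc n) (A - {j}) x) = cover p T (Suc n) B x + (\<Sum>j\<in>B. cover p T (Suc n) (A - {j}) x)"
      unfolding B_def by (rule sum.remove[OF Suc.prems(2) i(1)])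
    moreover have "(\<Sum>j\<in>A. cover_but p T j (Suc n) (A - {j}) x) = (\<Sum>j\<in>B. cover_but p T j (Suc n) (A - {j}) x)"
      unfolding B_def
      using sum.remove[OF Suc.prems(2) i(1), of "\<lambda>j. cover_but p T j (Suc n) (A - {j}) x"]
        cover_but_hit[of x T i p "Suc n" "A - {i}", OF i(2)] by linarith
    ultimately show ?thesis unfolding rest ci cA cB by (simp add: algebra_simps)
  qed
qed

text \<open>Write \<open>c\<close> for the cover value, \<open>S\<close> for the sum of the cover
  values with one target removed, \<open>D\<close> for the sum of the \<open>cover_but\<close> terms
  and \<open>q\<close> for \<open>card A\<close>. Then \<open>q * c + D / 2 \<le> S\<close> and
  \<open>S = (q - 1) * c + D\<close>; eliminating \<open>D\<close> gives
  \<open>(q + 1) * c \<le> S\<close>, and \<open>S \<le> q * (2 / q)\<close> by induction.\<close>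

lemma matthews_bound:
  assumes p: "0 \<le> p" "p \<le> 1"
    and half: "\<And>n i j x. x \<in> torus N d \<Longrightarrow> i \<in> A \<Longrightarrow> j \<in> A \<Longrightarrow> i \<noteq> j \<Longrightarrow> x \<in> T i \<Longrightarrow> cover p T n {j} x \<le> 1 / 2"
    and x: "x \<in> torus N d" and fin: "finite A"
  shows "cover p T n A x \<le> 2 / (real (card A) + 1)"
  using fin half
proof (induction "card A" arbitrary: A rule: less_induct)
  case less
  consider "card A = 0" | "card A = 1" | "card A \<ge> 2" by linarith
  thus ?case
  proof cases
    case 3
    have "A \<noteq> {}" using 3 by auto
    have "real (card A) * cover p T n A x + (\<Sum>j\<in>A. cover_but p T j n (A - {j}) x) / 2
       = (\<Sum>j\<in>A. cover p T n (insert j (A - {j})) x + cover_but p T j n (A - {j}) x / 2)"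
      by (simp add: sum.distrib insert_absorb sum_divide_distrib)
    also have "\<dots> \<le> (\<Sum>j\<in>A. cover p T n (A - {j}) x)"
    proof (rule sum_mono)
      fix j assume j: "j \<in> A"
      have "A - {j} \<noteq> {}"
      proof
        assume "A - {j} = {}"
        hence "A = {j}" using j by auto
        thus False using 3 by simp
      qed
      thus "cover p T n (insert j (A - {j})) x + cover_but p T j n (A - {j}) x / 2 \<le> cover p T n (A - {j}) x"
        using j by (intro cover_insert_le[OF p(1) less.prems(2) x]) auto
    qed
    finally have a: "real (card A) * cover p T n A x + (\<Sum>j\<in>A. cover_but p T j n (A - {j}) x) / 2
        \<le> (\<Sum>j\<in>A. cover p T n (A - {j}) x)" .
    have b: "(\<Sum>j\<in>A. cover p T n (A - {j}) x) =
      (real (card A) - 1) * cover p T n A x + (\<Sum>j\<in>A. cover_but p T j n (A - {j}) x)"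
      by (rule sum_cover_remove[OF x less.prems(1) 3])
    have "(real (card A) + 1) * cover p T n A x \<le> (\<Sum>j\<in>A. cover p T n (A - {j}) x)"
      using a b by (simp add: algebra_simps)
    also have "\<dots> \<le> (\<Sum>j\<in>A. 2 / real (card A))"
    proof (rule sum_mono)
      fix j assume j: "j \<in> A"
      have c: "card (A - {j}) = card A - 1" using j less.prems by simp
      have "cover p T n (A - {j}) x \<le> 2 / (real (card (A - {j})) + 1)"
        using less.hyps[of "A - {j}"] less.prems 3 c by auto
      thus "cover p T n (A - {j}) x \<le> 2 / real (card A)" using c 3 by (simp add: of_nat_diff)
    qed
    also have "\<dots> = 2" using 3 by simp
    finally show ?thesis by (simp add: field_simps)
  next
    case 1
    have "cover p T n A x \<le> 1" using cover_bounds[OF p x] by blast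
    thus ?thesis using 1 by simp
  next
    case 2
    have "cover p T n A x \<le> 1" using cover_bounds[OF p x] by blast
    thus ?thesis using 2 by simp
  qed
qed

end

end

section \<open>From recursions to the law of the walk\<close>

context torus_walk begin

lemma walk_path_case_nat: "walk_path N x (case_nat s \<xi>) (Suc n) = walk_path N (torus_step N x s) \<xi> n"
  by (induction n) auto

lemma measurable_walk_path_from:
  assumes "x \<in> torus N d"
  shows "(\<lambda>\<xi>. walk_path N x \<xi> n) \<in> step_seq_law d \<rightarrow>\<^sub>M count_space (torus N d)"
proof -
  have "(\<lambda>\<xi>. (x, \<xi>)) \<in> step_seq_law d \<rightarrow>\<^sub>M uniform_count_measure (torus N d) \<Otimes>\<^sub>M step_seq_law d"
    using assms by (intro measurable_Pair1') (simp add: space_uniform_count_measure)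
  from measurable_compose[OF this measurable_walk_path_nth[OF N_pos]] show ?thesis by simp
qed

lemma pred_walk_path_in [measurable]:
  "x \<in> torus N d \<Longrightarrow> Measurable.pred (step_seq_law d) (\<lambda>\<xi>. walk_path N x \<xi> n \<in> A)"
  by (rule measurable_compose[OF measurable_walk_path_from]) simp_all

lemma sets_step_seq_law_covered:
  assumes "x \<in> torus N d" "finite J"
  shows "{\<xi> \<in> space (step_seq_law d). \<forall>j\<in>J. \<exists>k\<le>n. walk_path N x \<xi> k \<in> T j} \<in> sets (step_seq_law d)"
  using assms by measurable

text \<open>An i.i.d. sequence has the law of an independent first increment put in front of a copy
  of itself (\<open>PiM_iter\<close>); integrating over the first increment by Fubini gives the
  Markov property at time 1.\<close>

lemma prob_first_step:
  assumes E: "E \<in> sets (step_seq_law d)"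
  shows "measure (step_seq_law d) E =
    (\<Sum>s\<in>step_set d. measure (step_seq_law d) {\<xi> \<in> space (step_seq_law d). case_nat s \<xi> \<in> E}) / real (2 * d)"
proof -
  let ?M = "uniform_count_measure (step_set d)"
  have PM: "prob_space ?M"
    using d_pos by (intro prob_space_uniform_count_measure) (auto simp: step_set_def)
  interpret sequence_space ?M
    by (intro sequence_space.intro product_prob_space.intro product_prob_space_axioms.intro
        product_sigma_finite.intro PM prob_space_imp_sigma_finite)
  have S: "step_seq_law d = S" by (simp add: step_seq_law_def)
  have PS: "prob_space S" using prob_space_step_seq_law[OF d_pos] by (simp add: S)
  have em: "emeasure S A = ennreal (measure S A)" for A
    by (intro finite_measure.emeasure_eq_measure prob_space.finite_measure PS)
  have ES: "E \<in> sets S" using E by (simp add: S)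
  have f: "(\<lambda>(s, \<omega>). case_nat s \<omega>) \<in> ?M \<Otimes>\<^sub>M S \<rightarrow>\<^sub>M S" by measurable
  have "emeasure S E = emeasure (distr (?M \<Otimes>\<^sub>M S) S (\<lambda>(s, \<omega>). case_nat s \<omega>)) E"
    by (simp only: PiM_iter)
  also have "\<dots> = emeasure (?M \<Otimes>\<^sub>M S) ((\<lambda>(s, \<omega>). case_nat s \<omega>) -` E \<inter> space (?M \<Otimes>\<^sub>M S))"
    by (rule emeasure_distr[OF f ES])
  also have "\<dots> = (\<integral>\<^sup>+ s. emeasure S (Pair s -` ((\<lambda>(s, \<omega>). case_nat s \<omega>) -` E \<inter> space (?M \<Otimes>\<^sub>M S))) \<partial>?M)"
    by (intro sigma_finite_measure.emeasure_pair_measure_alt prob_space_imp_sigma_finite PS measurable_sets[OF f ES])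
  also have "\<dots> = (\<Sum>s\<in>step_set d. ennreal (1 / card (step_set d)) *
      emeasure S (Pair s -` ((\<lambda>(s, \<omega>). case_nat s \<omega>) -` E \<inter> space (?M \<Otimes>\<^sub>M S))))"
    unfolding uniform_count_measure_def by (subst nn_integral_point_measure_finite) (auto simp: mult.commute)
  also have "\<dots> = (\<Sum>s\<in>step_set d. ennreal (1 / card (step_set d) * measure S {\<xi> \<in> space S. case_nat s \<xi> \<in> E}))"
  proof (rule sum.cong[OF refl])
    fix s assume "s \<in> step_set d"
    hence eq: "Pair s -` ((\<lambda>(s, \<omega>). case_nat s \<omega>) -` E \<inter> space (?M \<Otimes>\<^sub>M S)) = {\<xi> \<in> space S. case_nat s \<xi> \<in> E}"
      by (auto simp: space_pair_measure space_uniform_count_measure)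
    show "ennreal (1 / card (step_set d)) *
        emeasure S (Pair s -` ((\<lambda>(s, \<omega>). case_nat s \<omega>) -` E \<inter> space (?M \<Otimes>\<^sub>M S)))
      = ennreal (1 / card (step_set d) * measure S {\<xi> \<in> space S. case_nat s \<xi> \<in> E})"
      unfolding eq em by (rule ennreal_mult[symmetric]) auto
  qed
  also have "\<dots> = ennreal (\<Sum>s\<in>step_set d. 1 / card (step_set d) * measure S {\<xi> \<in> space S. case_nat s \<xi> \<in> E})"
    by (intro sum_ennreal) auto
  finally have "measure S E = (\<Sum>s\<in>step_set d. 1 / card (step_set d) * measure S {\<xi> \<in> space S. case_nat s \<xi> \<in> E})"
    by (simp add: measure_def sum_nonneg)
  thus ?thesis by (simp add: S card_step_set sum_divide_distrib)
qed

text \<open>The Markov property at time 1 reproduces the recursion of \<open>cover\<close> without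
  discount: targets containing the start are done, the others remain for the shifted walk.\<close>

lemma prob_covered:
  assumes "x \<in> torus N d" "finite J"
  shows "measure (step_seq_law d) {\<xi> \<in> space (step_seq_law d). \<forall>j\<in>J. \<exists>k\<le>n. walk_path N x \<xi> k \<in> T j}
    = cover 1 T n J x"
  using assms
proof (induction n arbitrary: x J)
  case 0
  interpret prob_space "step_seq_law d" by (rule prob_space_step_seq_law[OF d_pos])
  show ?case
  proof (cases "\<forall>j\<in>J. x \<in> T j")
    case False
    hence "{\<xi> \<in> space (step_seq_law d). \<forall>j\<in>J. \<exists>k\<le>0. walk_path N x \<xi> k \<in> T j} = {}" by auto
    thus ?thesis by (simp only: measure_empty) (use False in auto)
  qed (simp add: prob_space)
next
  case (Suc n)
  let ?J = "{j\<in>J. x \<notin> T j}"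
  let ?E = "\<lambda>n J x. {\<xi> \<in> space (step_seq_law d). \<forall>j\<in>J. \<exists>k\<le>n. walk_path N x \<xi> k \<in> T j}"
  have first: "(\<exists>k\<le>Suc n. walk_path N x (case_nat s \<xi>) k \<in> A) \<longleftrightarrow>
      x \<in> A \<or> (\<exists>k\<le>n. walk_path N (torus_step N x s) \<xi> k \<in> A)" for s \<xi> A
    unfolding less_Suc_eq_le[symmetric] Ex_less_Suc2 walk_path_case_nat by simp
  have "{\<xi> \<in> space (step_seq_law d). case_nat s \<xi> \<in> ?E (Suc n) J x} = ?E n ?J (torus_step N x s)"
    if "s \<in> step_set d" for s
    using that unfolding mem_Collect_eq first by (auto simp: space_step_seq_law split: nat.splits)
  hence "measure (step_seq_law d) (?E (Suc n) J x)
      = (\<Sum>s\<in>step_set d. measure (step_seq_law d) (?E n ?J (torus_step N x s))) / real (2 * d)"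
    by (subst prob_first_step[OF sets_step_seq_law_covered[OF Suc.prems]]) simp
  also have "\<dots> = (\<Sum>s\<in>step_set d. cover 1 T n ?J (torus_step N x s)) / real (2 * d)"
    using Suc.prems by (intro arg_cong2[where f = "(/)"] sum.cong refl Suc.IH step_in_torus) auto
  also have "\<dots> = avg (cover 1 T n ?J) x" by (simp add: avg_def)
  also have "\<dots> = cover 1 T (Suc n) J x"
  proof (cases "\<forall>j\<in>J. x \<in> T j")
    \<comment> \<open>\<open>cover\<close> stops here with value 1, which agrees with the average
      for an empty set of targets.\<close>
    case True
    hence J: "?J = {}" by auto
    moreover have "cover 1 T n {} = (\<lambda>_. 1)" by (rule ext) simp
    ultimately show ?thesis using True by (simp only: J cover.simps avg_const) simp
  qed auto
  finally show ?case .
qed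

text \<open>Fubini over the starting point: a bound valid for every start holds for the uniform
  one.\<close>

lemma walk_law_le:
  assumes F: "F \<in> sets (\<Pi>\<^sub>M n\<in>UNIV. count_space (torus N d))" and b: "0 \<le> b"
    and le: "\<And>x. x \<in> torus N d \<Longrightarrow>
      measure (step_seq_law d) {\<xi> \<in> space (step_seq_law d). walk_path N x \<xi> \<in> F} \<le> b"
  shows "measure (walk_law N d) F \<le> b"
proof -
  let ?U = "uniform_count_measure (torus N d)" and ?S = "step_seq_law d"
  let ?f = "\<lambda>(x, \<xi>). walk_path N x \<xi>"
  interpret U: prob_space ?U
    by (intro prob_space_uniform_count_measure finite_torus torus_nonempty N_pos)
  interpret S: prob_space ?S by (rule prob_space_step_seq_law[OF d_pos])
  note f = measurable_walk_path[OF N_pos, of d]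
  have "emeasure (walk_law N d) F = emeasure (?U \<Otimes>\<^sub>M ?S) (?f -` F \<inter> space (?U \<Otimes>\<^sub>M ?S))"
    unfolding walk_law_def by (rule emeasure_distr[OF f F])
  also have "\<dots> = (\<integral>\<^sup>+ x. emeasure ?S (Pair x -` (?f -` F \<inter> space (?U \<Otimes>\<^sub>M ?S))) \<partial>?U)"
    by (intro S.emeasure_pair_measure_alt measurable_sets[OF f F])
  also have "\<dots> \<le> (\<integral>\<^sup>+ x. ennreal b \<partial>?U)"
  proof (rule nn_integral_mono)
    fix x assume "x \<in> space ?U"
    hence x: "x \<in> torus N d" by (simp add: space_uniform_count_measure)
    hence "Pair x -` (?f -` F \<inter> space (?U \<Otimes>\<^sub>M ?S)) = {\<xi> \<in> space ?S. walk_path N x \<xi> \<in> F}"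
      by (auto simp: space_pair_measure space_uniform_count_measure)
    thus "emeasure ?S (Pair x -` (?f -` F \<inter> space (?U \<Otimes>\<^sub>M ?S))) \<le> ennreal b"
      using le[OF x] by (simp add: S.emeasure_eq_measure ennreal_leI)
  qed
  also have "\<dots> = ennreal b" by (simp add: U.emeasure_space_1)
  finally show ?thesis using b by (simp add: measure_def enn2real_leI)
qed

lemma sets_walk_law: "sets (walk_law N d) = sets (\<Pi>\<^sub>M n\<in>UNIV. count_space (torus N d))"
  by (simp add: walk_law_def)

lemma space_walk_law: "space (walk_law N d) = {\<omega>. \<forall>n. \<omega> n \<in> torus N d}"
  by (auto simp: walk_law_def space_PiM)

lemma pred_walk_law_in [measurable]: "Measurable.pred (walk_law N d) (\<lambda>\<omega>. \<omega> n \<in> B)"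
proof -
  have "(\<lambda>\<omega>. \<omega> n) \<in> walk_law N d \<rightarrow>\<^sub>M count_space (torus N d)"
    unfolding walk_law_def by simp
  thus ?thesis by (rule measurable_compose) simp
qed

lemma walk_path_in_space: "x \<in> torus N d \<Longrightarrow> \<xi> \<in> space (step_seq_law d) \<Longrightarrow> walk_path N x \<xi> \<in> space (walk_law N d)"
  by (auto simp: space_walk_law space_step_seq_law intro!: walk_path_in_torus[OF N_pos])

lemma walk_law_covered_le:
  assumes "finite J" "0 \<le> b" "\<And>x. x \<in> torus N d \<Longrightarrow> cover 1 T n J x \<le> b"
  shows "measure (walk_law N d) {\<omega> \<in> space (walk_law N d). \<forall>j\<in>J. \<exists>k\<le>n. \<omega> k \<in> T j} \<le> b"
proof (rule walk_law_le)
  show "{\<omega> \<in> space (walk_law N d). \<forall>j\<in>J. \<exists>k\<le>n. \<omega> k \<in> T j} \<in> sets (\<Pi>\<^sub>M n\<in>UNIV. count_space (torus N d))"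
    unfolding sets_walk_law[symmetric] using assms(1) by measurable
  fix x assume x: "x \<in> torus N d"
  have "{\<xi> \<in> space (step_seq_law d). walk_path N x \<xi> \<in> {\<omega> \<in> space (walk_law N d). \<forall>j\<in>J. \<exists>k\<le>n. \<omega> k \<in> T j}}
     = {\<xi> \<in> space (step_seq_law d). \<forall>j\<in>J. \<exists>k\<le>n. walk_path N x \<xi> k \<in> T j}"
    using walk_path_in_space[OF x] by auto
  thus "measure (step_seq_law d) {\<xi> \<in> space (step_seq_law d).
     walk_path N x \<xi> \<in> {\<omega> \<in> space (walk_law N d). \<forall>j\<in>J. \<exists>k\<le>n. \<omega> k \<in> T j}} \<le> b"
    using prob_covered[OF x assms(1)] assms(3)[OF x] by simp
qed (rule assms)

lemma walk_law_avoid_le: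
  assumes "0 \<le> b" "\<And>x. x \<in> torus N d \<Longrightarrow> 1 - cover 1 (\<lambda>_::unit. A) n {()} x \<le> b"
  shows "measure (walk_law N d) {\<omega> \<in> space (walk_law N d). \<forall>k\<le>n. \<omega> k \<notin> A} \<le> b"
proof (rule walk_law_le)
  show "{\<omega> \<in> space (walk_law N d). \<forall>k\<le>n. \<omega> k \<notin> A} \<in> sets (\<Pi>\<^sub>M n\<in>UNIV. count_space (torus N d))"
    unfolding sets_walk_law[symmetric] by measurable
  fix x assume x: "x \<in> torus N d"
  interpret prob_space "step_seq_law d" by (rule prob_space_step_seq_law[OF d_pos])
  let ?C = "{\<xi> \<in> space (step_seq_law d). \<forall>j\<in>{()}. \<exists>k\<le>n. walk_path N x \<xi> k \<in> A}"
  have "{\<xi> \<in> space (step_seq_law d). walk_path N x \<xi> \<in> {\<omega> \<in> space (walk_law N d). \<forall>k\<le>n. \<omega> k \<notin> A}}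
     = space (step_seq_law d) - ?C"
    using walk_path_in_space[OF x] by auto
  also have "measure (step_seq_law d) \<dots> = 1 - measure (step_seq_law d) ?C"
    by (rule prob_compl[OF sets_step_seq_law_covered[OF x]]) simp
  also have "measure (step_seq_law d) ?C = cover 1 (\<lambda>_::unit. A) n {()} x"
    by (rule prob_covered[OF x]) simp
  finally show "measure (step_seq_law d) {\<xi> \<in> space (step_seq_law d).
     walk_path N x \<xi> \<in> {\<omega> \<in> space (walk_law N d). \<forall>k\<le>n. \<omega> k \<notin> A}} \<le> b"
    using assms(2)[OF x] by simp
qed (rule assms)

end

section \<open>Geometry of balls in the torus\<close>

text \<open>Together with \<open>cyc_dist_attained\<close> this describes \<open>cyc_dist\<close> as
  a minimum over representatives, from which the triangle inequality follows.\<close>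

lemma cyc_dist_le:
  assumes "N > 0"
  shows "cyc_dist N a b \<le> \<bar>a - b + k * int N\<bar>"
proof (cases "a - b + k * int N \<ge> 0")
  case True
  have "(a - b) mod int N = (a - b + k * int N) mod int N" by simp
  also have "\<dots> \<le> a - b + k * int N" using True by (rule zmod_le_nonneg_dividend)
  finally show ?thesis by (simp add: cyc_dist_def)
next
  case False
  have "(b - a) mod int N = (b - a + (- k) * int N) mod int N" by (simp only: mod_mult_self1)
  also have "\<dots> \<le> b - a + (- k) * int N" using False by (intro zmod_le_nonneg_dividend) simp
  finally show ?thesis using False by (simp add: cyc_dist_def)
qed

lemma cyc_dist_attained:
  assumes "N > 0"
  obtains k where "cyc_dist N a b = \<bar>a - b + k * int N\<bar>"
proof (cases "(a - b) mod int N \<le> (b - a) mod int N")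
  case True
  have "cyc_dist N a b = (a - b) mod int N" using True by (simp add: cyc_dist_def)
  also have "\<dots> = \<bar>(a - b) mod int N\<bar>" using assms by simp
  also have "(a - b) mod int N = a - b + (- ((a - b) div int N)) * int N"
    by (simp add: minus_div_mult_eq_mod[symmetric])
  finally show ?thesis by (rule that)
next
  case False
  have "cyc_dist N a b = (b - a) mod int N" using False by (simp add: cyc_dist_def)
  also have "\<dots> = \<bar>- ((b - a) mod int N)\<bar>" using assms by simp
  also have "- ((b - a) mod int N) = a - b + ((b - a) div int N) * int N"
    by (simp add: minus_div_mult_eq_mod[symmetric])
  finally show ?thesis by (rule that)
qed

lemma cyc_dist_nonneg: "N > 0 \<Longrightarrow> 0 \<le> cyc_dist N a b"
  by (simp add: cyc_dist_def)

lemma cyc_dist_self [simp]: "cyc_dist N a a = 0"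
  by (simp add: cyc_dist_def)

lemma cyc_dist_commute: "cyc_dist N a b = cyc_dist N b a"
  by (simp add: cyc_dist_def min.commute)

lemma cyc_dist_triangle:
  assumes "N > 0"
  shows "cyc_dist N a c \<le> cyc_dist N a b + cyc_dist N b c"
proof -
  obtain k where k: "cyc_dist N a b = \<bar>a - b + k * int N\<bar>" by (rule cyc_dist_attained[OF assms])
  obtain l where l: "cyc_dist N b c = \<bar>b - c + l * int N\<bar>" by (rule cyc_dist_attained[OF assms])
  have "cyc_dist N a c \<le> \<bar>a - c + (k + l) * int N\<bar>" by (rule cyc_dist_le[OF assms])
  also have "\<dots> = \<bar>(a - b + k * int N) + (b - c + l * int N)\<bar>" by (simp add: algebra_simps)
  finally show ?thesis using k l by linarith
qed

text \<open>The representative \<open>k\<close> is free, so that one choice serves both signs of a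
  step in \<open>lazy_sq_disp_le\<close>.\<close>

lemma cyc_dist_shift_le:
  assumes "N > 0"
  shows "cyc_dist N a ((b + t) mod int N) \<le> \<bar>a - b + k * int N - t\<bar>"
proof -
  have "(b + t) mod int N = b + t - int N * ((b + t) div int N)" by (simp add: minus_mult_div_eq_mod)
  hence "a - (b + t) mod int N + (k - (b + t) div int N) * int N = a - b + k * int N - t"
    by (simp add: algebra_simps)
  thus ?thesis using cyc_dist_le[OF assms, of a "(b + t) mod int N" "k - (b + t) div int N"] by simp
qed

lemma card_cyc_ball_le:
  assumes "N > 0"
  shows "card {b \<in> {0..<int N}. cyc_dist N a b \<le> int m} \<le> 2 * m + 1"
proof -
  have "{b \<in> {0..<int N}. cyc_dist N a b \<le> int m} \<subseteq> (\<lambda>t. (a + t) mod int N) ` {- int m..int m}"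
  proof
    fix b assume b: "b \<in> {b \<in> {0..<int N}. cyc_dist N a b \<le> int m}"
    obtain k where k: "cyc_dist N a b = \<bar>a - b + k * int N\<bar>" by (rule cyc_dist_attained[OF assms])
    have "(a + (- (a - b + k * int N))) mod int N = (b + (- k) * int N) mod int N"
      by (rule arg_cong[of _ _ "\<lambda>x. x mod int N"]) (simp add: algebra_simps)
    also have "\<dots> = b mod int N" by (rule mod_mult_self1)
    also have "\<dots> = b" using b by simp
    finally have "b = (a + (- (a - b + k * int N))) mod int N" by simp
    moreover have "- (a - b + k * int N) \<in> {- int m..int m}" using b k by auto
    ultimately show "b \<in> (\<lambda>t. (a + t) mod int N) ` {- int m..int m}" by (rule image_eqI)
  qed
  hence "card {b \<in> {0..<int N}. cyc_dist N a b \<le> int m} \<le> card ((\<lambda>t. (a + t) mod int N) ` {- int m..int m})"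
    by (intro card_mono) auto
  also have "\<dots> \<le> card {- int m..int m}" by (rule card_image_le) simp
  finally show ?thesis by simp
qed

text \<open>Only the points on one side of \<open>a\<close> are counted: they stay distinct modulo
  \<open>N\<close> for every \<open>m < N\<close>, whereas the two sides may overlap.\<close>

lemma card_cyc_ball_ge:
  assumes "m < N"
  shows "m + 1 \<le> card {b \<in> {0..<int N}. cyc_dist N a b \<le> int m}"
proof -
  have N: "N > 0" using assms by simp
  have "inj_on (\<lambda>t. (a + t) mod int N) {0..int m}"
  proof (rule inj_onI)
    fix s t assume st: "s \<in> {0..int m}" "t \<in> {0..int m}" "(a + s) mod int N = (a + t) mod int N"
    hence "int N dvd s - t" by (simp add: mod_eq_dvd_iff)
    moreover have "\<bar>s - t\<bar> < int N" using st assms by auto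
    ultimately show "s = t" using zdvd_not_zless[of "\<bar>s - t\<bar>" "int N"] by auto
  qed
  hence "m + 1 = card ((\<lambda>t. (a + t) mod int N) ` {0..int m})" by (simp add: card_image)
  also have "\<dots> \<le> card {b \<in> {0..<int N}. cyc_dist N a b \<le> int m}"
  proof (rule card_mono)
    show "(\<lambda>t. (a + t) mod int N) ` {0..int m} \<subseteq> {b \<in> {0..<int N}. cyc_dist N a b \<le> int m}"
    proof safe
      fix t assume t: "t \<in> {0..int m}"
      show "(a + t) mod int N \<in> {0..<int N}" using N by simp
      show "cyc_dist N a ((a + t) mod int N) \<le> int m"
        using cyc_dist_shift_le[OF N, of a a t 0] t by simp
    qed
  qed (rule finite_subset[of _ "{0..<int N}"], auto)
  finally show ?thesis .
qed

context torus_walk begin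

lemma torus_dist_le_iff: "torus_dist N d x y \<le> m \<longleftrightarrow> (\<forall>i<d. cyc_dist N (x i) (y i) \<le> m)"
proof -
  have "(\<lambda>i. cyc_dist N (x i) (y i)) ` {..<d} \<noteq> {}" using d_pos by auto
  thus ?thesis unfolding torus_dist_def by (subst Max_le_iff) auto
qed

lemma in_torus_ball_iff: "y \<in> torus_ball N d x m \<longleftrightarrow> y \<in> torus N d \<and> (\<forall>i<d. cyc_dist N (x i) (y i) \<le> int m)"
  by (simp add: torus_ball_def torus_dist_le_iff)

lemma torus_ball_subset: "torus_ball N d x m \<subseteq> torus N d"
  by (auto simp: torus_ball_def)

lemma finite_torus_ball: "finite (torus_ball N d x m)"
  by (rule finite_subset[OF torus_ball_subset finite_torus])

lemma torus_ball_mono: "m \<le> m' \<Longrightarrow> torus_ball N d x m \<subseteq> torus_ball N d x m'"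
  by (auto simp: torus_ball_def)

lemma torus_ball_subset_double:
  assumes "w \<in> torus_ball N d x m"
  shows "torus_ball N d w m \<subseteq> torus_ball N d x (2 * m)"
proof
  fix y assume y: "y \<in> torus_ball N d w m"
  show "y \<in> torus_ball N d x (2 * m)"
    unfolding in_torus_ball_iff
  proof (intro conjI allI impI)
    fix i assume i: "i < d"
    have "cyc_dist N (x i) (w i) \<le> int m" "cyc_dist N (w i) (y i) \<le> int m"
      using assms y i by (auto simp: in_torus_ball_iff)
    thus "cyc_dist N (x i) (y i) \<le> int (2 * m)"
      using cyc_dist_triangle[OF N_pos, of "x i" "y i" "w i"] by simp
  qed (use y in \<open>simp add: in_torus_ball_iff\<close>)
qed

lemma torus_ball_eq_PiE: "torus_ball N d x m = (\<Pi>\<^sub>E i\<in>{..<d}. {b \<in> {0..<int N}. cyc_dist N (x i) b \<le> int m})"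
  unfolding set_eq_iff in_torus_ball_iff torus_def PiE_iff by blast

lemma card_torus_ball_le: "card (torus_ball N d x m) \<le> (2 * m + 1) ^ d"
proof -
  have "card (torus_ball N d x m) = (\<Prod>i<d. card {b \<in> {0..<int N}. cyc_dist N (x i) b \<le> int m})"
    unfolding torus_ball_eq_PiE by (simp add: card_PiE)
  also have "\<dots> \<le> (\<Prod>i<d. 2 * m + 1)" by (intro prod_mono) (auto intro: card_cyc_ball_le[OF N_pos, simplified])
  finally show ?thesis by simp
qed

lemma card_torus_ball_ge:
  assumes "m < N"
  shows "(m + 1) ^ d \<le> card (torus_ball N d x m)"
proof -
  have "(m + 1) ^ d = (\<Prod>i<d. m + 1)" by simp
  also have "\<dots> \<le> (\<Prod>i<d. card {b \<in> {0..<int N}. cyc_dist N (x i) b \<le> int m})"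
    using card_cyc_ball_ge[OF assms] by (intro prod_mono) auto
  also have "\<dots> = card (torus_ball N d x m)"
    unfolding torus_ball_eq_PiE by (simp add: card_PiE)
  finally show ?thesis .
qed

section \<open>Spread of the lazy walk: diffusive bound and finite speed\<close>

definition sq_disp :: "(nat \<Rightarrow> int) \<Rightarrow> (nat \<Rightarrow> int) \<Rightarrow> real" where
  "sq_disp w y = (\<Sum>i<d. (of_int (cyc_dist N (w i) (y i)))\<^sup>2)"

text \<open>With \<open>t\<close> a representative attaining the distance in coordinate
  \<open>i\<close>, the squares of \<open>t - 1\<close> and \<open>t + 1\<close> average to
  \<open>t\<^sup>2 + 1\<close>; wrapping around the torus can only shorten distances.\<close>

lemma lazy_sq_disp_le: "lazy (sq_disp w) y \<le> sq_disp w y + 1"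
proof -
  have "(sq_disp w (y(i := (y i + 1) mod int N)) + sq_disp w (y(i := (y i - 1) mod int N))) / 2 \<le> sq_disp w y + 1"
    if i: "i < d" for i
  proof -
    obtain k where k: "cyc_dist N (w i) (y i) = \<bar>w i - y i + k * int N\<bar>" by (rule cyc_dist_attained[OF N_pos])
    define t where "t = w i - y i + k * int N"
    define R where "R = (\<Sum>j\<in>{..<d} - {i}. (of_int (cyc_dist N (w j) (y j)))\<^sup>2 :: real)"
    have upd: "sq_disp w (y(i := b)) = (of_int (cyc_dist N (w i) b))\<^sup>2 + R" for b
      using i unfolding sq_disp_def R_def by (subst sum.remove[of _ i]) (auto intro!: sum.cong)
    have "cyc_dist N (w i) ((y i + s) mod int N) \<le> \<bar>t - s\<bar>" for s
      unfolding t_def by (rule cyc_dist_shift_le[OF N_pos])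
    hence shift: "(of_int (cyc_dist N (w i) ((y i + s) mod int N)))\<^sup>2 \<le> (of_int t - of_int s :: real)\<^sup>2" for s
      by (subst abs_le_square_iff[symmetric]) (simp add: cyc_dist_nonneg[OF N_pos] flip: of_int_diff of_int_abs)
    have "sq_disp w y = (of_int t)\<^sup>2 + R" using upd[of "y i"] k by (simp add: t_def)
    thus ?thesis unfolding upd using shift[of 1] shift[of "-1"] by (simp add: power2_eq_square algebra_simps)
  qed
  hence "avg (sq_disp w) y \<le> (\<Sum>i<d. sq_disp w y + 1) / real d"
    unfolding avg_coord by (intro divide_right_mono sum_mono) auto
  hence "avg (sq_disp w) y \<le> sq_disp w y + 1" using d_pos by simp
  thus ?thesis by (simp add: lazy_def)
qed

text \<open>Chebyshev's inequality: outside the ball some coordinate is off by at least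
  \<open>m + 1\<close>, and the squared displacement grows in mean by at most 1 per step.\<close>

lemma lazy_iter_ball_ge_aux:
  assumes "y \<in> torus N d"
  shows "1 - (sq_disp w y + real n) / (real m + 1)\<^sup>2 \<le> (lazy ^^ n) (indicator (torus_ball N d w m)) y"
  using assms
proof (induction n arbitrary: y)
  case 0
  show ?case
  proof (cases "y \<in> torus_ball N d w m")
    case True
    thus ?thesis by (simp add: sq_disp_def sum_nonneg)
  next
    case False
    then obtain i where i: "i < d" "cyc_dist N (w i) (y i) > int m"
      using 0 by (auto simp: in_torus_ball_iff not_le)
    have "(real m + 1)\<^sup>2 \<le> (of_int (cyc_dist N (w i) (y i)))\<^sup>2" using i by (intro power_mono) auto
    also have "\<dots> \<le> sq_disp w y" unfolding sq_disp_def using i by (intro member_le_sum) auto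
    finally show ?thesis using False by (simp add: field_simps)
  qed
next
  case (Suc n)
  define M where "M = (real m + 1)\<^sup>2"
  have M: "M > 0" by (simp add: M_def add_nonneg_pos)
  have "1 - (sq_disp w y + real (Suc n)) / M \<le> (1 - real n / M) + (- 1 / M) * lazy (sq_disp w) y"
    using divide_right_mono[OF lazy_sq_disp_le[of w y], of M] M by (simp add: add_divide_distrib)
  also have "\<dots> = lazy (\<lambda>y. (1 - real n / M) + (- 1 / M) * sq_disp w y) y"
    by (simp only: lazy_add lazy_cmult lazy_const)
  also have "\<dots> \<le> lazy ((lazy ^^ n) (indicator (torus_ball N d w m))) y"
    using Suc.IH by (intro lazy_mono Suc.prems) (simp add: M_def add_divide_distrib diff_diff_eq add.commute)
  finally show ?case by (simp add: M_def)
qed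

lemma lazy_iter_ball_ge:
  assumes "w \<in> torus N d"
  shows "1 - real n / (real m + 1)\<^sup>2 \<le> (lazy ^^ n) (indicator (torus_ball N d w m)) w"
  using lazy_iter_ball_ge_aux[OF assms, of w n m] by (simp add: sq_disp_def)

text \<open>A step changes coordinate 0 by at most 1, so the ball is out of reach. Coordinate 0 is
  the one in which the centers chosen later differ.\<close>

lemma lazy_iter_ball_far:
  assumes "x \<in> torus N d" "int (m + n) < cyc_dist N (c 0) (x 0)"
  shows "(lazy ^^ n) (indicator (torus_ball N d c m)) x = 0"
  using assms
proof (induction n arbitrary: x)
  case 0
  thus ?case using d_pos by (auto simp: in_torus_ball_iff indicator_def)
next
  case (Suc n)
  let ?f = "(lazy ^^ n) (indicator (torus_ball N d c m))"
  have "?f (torus_step N x s) = 0" if s: "s \<in> step_set d" for s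
  proof (rule Suc.IH[OF step_in_torus[OF Suc.prems(1) s]])
    obtain i e where ie: "s = (i, e)" "e \<in> {-1, 1}" using s by (auto simp: step_set_def)
    have "cyc_dist N (x 0) (torus_step N x s 0) \<le> 1"
      using ie cyc_dist_shift_le[OF N_pos, of "x 0" "x 0" e 0] by (auto simp: torus_step_def)
    moreover have "cyc_dist N (c 0) (x 0) \<le> cyc_dist N (c 0) (torus_step N x s 0) + cyc_dist N (torus_step N x s 0) (x 0)"
      by (rule cyc_dist_triangle[OF N_pos])
    ultimately show "int (m + n) < cyc_dist N (c 0) (torus_step N x s 0)"
      using Suc.prems(2) cyc_dist_commute[of N "x 0" "torus_step N x s 0"] by simp
  qed
  moreover have "?f x = 0" using Suc by simp
  ultimately have "?f x + avg ?f x = 0" unfolding avg_def by simp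
  thus ?case by (simp add: lazy_def[of ?f])
qed

end

section \<open>Upper bound: every ball is hit\<close>

text \<open>Telescoping: with \<open>s = sqrt b\<close> and \<open>t = sqrt (b + 1)\<close>, the
  difference \<open>2 / s - 2 / t\<close> equals \<open>2 / (s * t * (t + s))\<close>, which is at
  least \<open>1 / t ^ 3\<close> since \<open>s \<le> t\<close>.\<close>

lemma sum_inverse_three_halves_le:
  assumes "a > 0" "a \<le> b"
  shows "(\<Sum>n\<in>{a<..b}. 1 / (real n * sqrt (real n))) \<le> 2 / sqrt (real a) - 2 / sqrt (real b)"
  using assms(2)
proof (induction b rule: dec_induct)
  case (step b)
  define s where "s = sqrt (real b)"
  define t where "t = sqrt (real (Suc b))"
  have b: "b > 0" using step assms by simp
  have s: "s > 0" "s * s = real b" and t: "t > 0" "t * t = real (Suc b)" and st: "s \<le> t"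
    using b by (simp_all add: s_def t_def)
  have "1 / (t * t * t) \<le> 2 / s - 2 / t"
  proof -
    have "t - s = 1 / (t + s)" using s t by (simp add: field_simps)
    moreover have "2 / s - 2 / t = 2 * (t - s) / (s * t)" using s t by (simp add: field_simps)
    ultimately have "2 / s - 2 / t = 2 / (s * t * (t + s))" by simp
    moreover have "s * t * (t + s) \<le> t * t * (t + t)" using s t st by (intro mult_mono) auto
    hence "2 / (t * t * (t + t)) \<le> 2 / (s * t * (t + s))" using s t by (intro divide_left_mono) auto
    moreover have "t * t * (t + t) = 2 * (t * t * t)" by (simp add: algebra_simps)
    ultimately show ?thesis by simp
  qed
  moreover have "{a<..Suc b} = insert (Suc b) {a<..b}" using step by auto
  ultimately show ?case using step.IH t(2) by (simp add: s_def t_def)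
qed simp

text \<open>The source of transience: three factors \<open>sqrt n\<close> make the series summable,
  and the other \<open>d - 3\<close> are replaced by the smaller \<open>sqrt a\<close>.\<close>

lemma sum_inverse_sqrt_power_le:
  assumes "a > 0" "a \<le> b" "d \<ge> 3"
  shows "(\<Sum>n\<in>{a<..b}. 1 / sqrt (real n) ^ d) \<le> 2 / sqrt (real a) ^ (d - 2)"
proof -
  have d: "d = 3 + (d - 3)" "d - 2 = Suc (d - 3)" using assms by auto
  have "(\<Sum>n\<in>{a<..b}. 1 / sqrt (real n) ^ d) \<le> (\<Sum>n\<in>{a<..b}. 1 / (real n * sqrt (real n)) * (1 / sqrt (real a) ^ (d - 3)))"
  proof (rule sum_mono)
    fix n assume n: "n \<in> {a<..b}"
    have "sqrt (real n) ^ d = real n * sqrt (real n) * sqrt (real n) ^ (d - 3)"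
      by (subst d(1)) (simp add: power_add power3_eq_cube)
    also have "\<dots> \<ge> real n * sqrt (real n) * sqrt (real a) ^ (d - 3)"
      using n by (intro mult_left_mono power_mono) auto
    finally have "1 / sqrt (real n) ^ d \<le> 1 / (real n * sqrt (real n) * sqrt (real a) ^ (d - 3))"
      using n assms by (intro divide_left_mono mult_pos_pos) auto
    thus "1 / sqrt (real n) ^ d \<le> 1 / (real n * sqrt (real n)) * (1 / sqrt (real a) ^ (d - 3))" by simp
  qed
  also have "\<dots> = (\<Sum>n\<in>{a<..b}. 1 / (real n * sqrt (real n))) * (1 / sqrt (real a) ^ (d - 3))"
    by (rule sum_distrib_right[symmetric])
  also have "\<dots> \<le> 2 / sqrt (real a) * (1 / sqrt (real a) ^ (d - 3))"
    using sum_inverse_three_halves_le[OF assms(1,2)] by (intro mult_right_mono) (auto intro: order_trans)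
  also have "\<dots> = 2 / sqrt (real a) ^ (d - 2)" by (simp add: d(2))
  finally show ?thesis .
qed

lemma power_split_two:
  fixes x :: "'a::monoid_mult"
  assumes "d \<ge> 2"
  shows "x ^ d = x ^ (d - 2) * x ^ 2"
proof -
  have "d = d - 2 + 2" using assms by simp
  thus ?thesis by (metis power_add)
qed

definition heat_const :: "nat \<Rightarrow> real" where
  "heat_const d = (4 * sqrt (real d)) ^ d"

text \<open>Half the inverse of the constant in \<open>visits_ball_le\<close>; the half stems from
  \<open>visits_ball_ge\<close>.\<close>

definition hit_const :: "nat \<Rightarrow> real" where
  "hit_const d = 1 / (4 + 8 * 3 ^ d * heat_const d)"

lemma heat_const_nonneg: "0 \<le> heat_const d"
  by (simp add: heat_const_def)

lemma hit_const_pos: "0 < hit_const d"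
  by (simp add: hit_const_def heat_const_nonneg add_pos_nonneg)

context torus_walk begin

text \<open>Through the maximum \<open>M\<close> of \<open>1 / N\<close> and
  \<open>1 / sqrt n\<close>, the power of a sum in \<open>lazy_kernel_le\<close> turns into a sum of
  powers.\<close>

lemma lazy_kernel_le':
  assumes "x \<in> torus N d" "w \<in> torus N d" "n > 0"
  shows "(lazy ^^ n) (indicator {w}) x \<le> heat_const d * (1 / real N ^ d + 1 / sqrt (real n) ^ d)"
proof -
  define M where "M = max (1 / real N) (1 / sqrt (real n))"
  have M: "0 \<le> M" by (simp add: M_def le_max_iff_disj)
  have "2 / real N \<le> 2 * M" by (simp add: M_def)
  also have "\<dots> \<le> 2 * sqrt (real d) * M" using d_pos M by (intro mult_right_mono) auto
  finally have "2 / real N + 2 * sqrt (real d) / sqrt (real n) \<le> 2 * sqrt (real d) * M + 2 * sqrt (real d) * (1 / sqrt (real n))"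
    by simp
  also have "\<dots> \<le> 2 * sqrt (real d) * M + 2 * sqrt (real d) * M"
    by (intro add_left_mono mult_left_mono) (auto simp: M_def)
  finally have "(2 / real N + 2 * sqrt (real d) / sqrt (real n)) ^ d \<le> (4 * sqrt (real d) * M) ^ d"
    by (intro power_mono) (auto simp: mult_ac)
  also have "\<dots> = heat_const d * M ^ d" by (simp add: heat_const_def power_mult_distrib)
  also have "M ^ d \<le> (1 / real N) ^ d + (1 / sqrt (real n)) ^ d"
    by (auto simp: M_def max_def)
  finally show ?thesis using lazy_kernel_le[OF assms] heat_const_nonneg[of d]
    by (simp add: power_one_over mult_left_mono)
qed

lemma lazy_iter_indicator_le:
  assumes "x \<in> torus N d" "A \<subseteq> torus N d" "n > 0" "real (card A) \<le> c"
  shows "(lazy ^^ n) (indicator A) x \<le> c * heat_const d * (1 / real N ^ d + 1 / sqrt (real n) ^ d)"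
proof -
  have "finite A" using assms(2) finite_torus finite_subset by blast
  hence "(lazy ^^ n) (indicator A) x = (\<Sum>w\<in>A. (lazy ^^ n) (indicator {w}) x)"
    by (rule lazy_iter_indicator_sum)
  also have "\<dots> \<le> (\<Sum>w\<in>A. heat_const d * (1 / real N ^ d + 1 / sqrt (real n) ^ d))"
    using assms by (intro sum_mono lazy_kernel_le') auto
  also have "\<dots> = real (card A) * (heat_const d * (1 / real N ^ d + 1 / sqrt (real n) ^ d))" by simp
  also have "\<dots> \<le> c * (heat_const d * (1 / real N ^ d + 1 / sqrt (real n) ^ d))"
    using assms by (intro mult_right_mono mult_nonneg_nonneg heat_const_nonneg) auto
  finally show ?thesis by (simp add: mult_ac)
qed

section \<open>Hitting probabilities of a single set\<close>

abbreviation hit :: "(nat \<Rightarrow> int) set \<Rightarrow> nat \<Rightarrow> (nat \<Rightarrow> int) \<Rightarrow> real" where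
  "hit A n x \<equiv> cover 1 (\<lambda>_::unit. A) n {()} x"

lemma hit_in: "x \<in> A \<Longrightarrow> hit A n x = 1"
  by (intro cover_all) auto

lemma hit_notin:
  assumes "x \<notin> A"
  shows "hit A (Suc n) x = avg (hit A n) x"
proof -
  have "{j \<in> {()}. x \<notin> A} = {()}" using assms by auto
  from cover_Suc_step[where T = "\<lambda>_. A" and p = 1 and n = n, OF this] show ?thesis
    by (simp only: mult_1) simp
qed

lemma hit_bounds: "x \<in> torus N d \<Longrightarrow> 0 \<le> hit A n x \<and> hit A n x \<le> 1"
  by (intro cover_bounds) auto

lemma hit_Suc_ge: "x \<in> torus N d \<Longrightarrow> hit A n x \<le> hit A (Suc n) x"
proof (induction n arbitrary: x)
  case 0
  show ?case
  proof (cases "x \<in> A")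
    case False
    thus ?thesis using hit_bounds[OF 0, of A "Suc 0"] by simp
  qed (simp add: hit_in)
next
  case (Suc n)
  show ?case
  proof (cases "x \<in> A")
    case False
    show ?thesis unfolding hit_notin[OF False] by (rule avg_mono) (use Suc in auto)
  qed (simp add: hit_in)
qed

text \<open>Visits of the lazy walk are counted only once it has hit \<open>A\<close>, and from
  there at most \<open>M\<close> are expected. The right-hand side speaks of the walk without
  laziness, which hits \<open>A\<close> no later.\<close>

lemma visits_le_hit:
  assumes M: "\<And>w. w \<in> A \<Longrightarrow> w \<in> torus N d \<Longrightarrow> (\<Sum>k\<le>n0. (lazy ^^ k) (indicator A) w) \<le> M" and "0 \<le> M"
    and "n \<le> n0" "x \<in> torus N d"
  shows "(\<Sum>k\<le>n. (lazy ^^ k) (indicator A) x) \<le> M * hit A n x"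
  using assms(3,4)
proof (induction n arbitrary: x)
  case 0
  show ?case
  proof (cases "x \<in> A")
    case True
    have "(\<Sum>k\<le>0. (lazy ^^ k) (indicator A) x) \<le> (\<Sum>k\<le>n0. (lazy ^^ k) (indicator A) x)"
      using 0 by (intro sum_mono2) (auto intro: lazy_iter_indicator_nonneg)
    thus ?thesis using M[OF True 0(2)] True by simp
  qed simp
next
  case (Suc n)
  let ?v = "\<lambda>n x. \<Sum>k\<le>n. (lazy ^^ k) (indicator A) x :: real"
  show ?case
  proof (cases "x \<in> A")
    case True
    have "?v (Suc n) x \<le> ?v n0 x"
      using Suc.prems by (intro sum_mono2) (auto intro: lazy_iter_indicator_nonneg simp del: funpow.simps)
    also have "\<dots> \<le> M" by (rule M[OF True Suc.prems(2)])
    finally show ?thesis unfolding hit_in[OF True] mult_1_right .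
  next
    case False
    have "?v (Suc n) x = (\<Sum>k\<in>insert 0 (Suc ` {..n}). (lazy ^^ k) (indicator A) x)"
      by (simp only: atMost_Suc_eq_insert_0)
    also have "\<dots> = (\<Sum>k\<le>n. lazy ((lazy ^^ k) (indicator A)) x)"
      using False by (subst sum.insert) (auto simp: sum.reindex)
    also have "\<dots> = lazy (?v n) x" by (rule lazy_sum[symmetric])
    also have "\<dots> \<le> lazy (\<lambda>y. M * hit A n y) x"
      using Suc by (intro lazy_mono) auto
    \<comment> \<open>A lazy step averages \<open>hit A n\<close> and \<open>hit A (Suc n)\<close>;
      monotonicity in time absorbs the delay.\<close>
    also have "\<dots> = M * ((hit A n x + hit A (Suc n) x) / 2)"
      unfolding lazy_cmult lazy_def hit_notin[OF False] ..
    also have "\<dots> \<le> M * hit A (Suc n) x"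
      using hit_Suc_ge[OF Suc.prems(2), of A n] assms(2) by (intro mult_left_mono) auto
    finally show ?thesis .
  qed
qed

text \<open>Markov property at time \<open>a\<close>: whatever the position then, avoiding
  \<open>A\<close> for \<open>b\<close> more steps has probability at most
  \<open>\<beta>\<close>.\<close>

lemma avoid_add_le:
  assumes "x \<in> torus N d" "\<And>y. y \<in> torus N d \<Longrightarrow> 1 - hit A b y \<le> \<beta>" "0 \<le> \<beta>"
  shows "1 - hit A (a + b) x \<le> (1 - hit A a x) * \<beta>"
  using assms(1)
proof (induction a arbitrary: x)
  case 0
  show ?case
  proof (cases "x \<in> A")
    case False
    thus ?thesis using assms(2)[OF 0] by simp
  qed (simp add: hit_in)
next
  case (Suc a)
  show ?case
  proof (cases "x \<in> A")
    case False
    have compl: "1 - avg f x = avg (\<lambda>y. 1 + (- 1) * f y) x" for f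
      by (simp only: avg_add avg_cmult avg_const)
    have "1 - hit A (Suc a + b) x = avg (\<lambda>y. 1 + (- 1) * hit A (a + b) y) x"
      using hit_notin[OF False] by (simp only: compl add_Suc)
    also have "\<dots> \<le> avg (\<lambda>y. \<beta> * (1 + (- 1) * hit A a y)) x"
      using Suc by (intro avg_mono) (auto simp: mult.commute)
    also have "\<dots> = (1 - hit A (Suc a) x) * \<beta>"
      unfolding avg_cmult hit_notin[OF False] compl by (rule mult.commute)
    finally show ?thesis .
  qed (simp add: hit_in)
qed

lemma avoid_power_le:
  assumes "x \<in> torus N d" "\<And>y. y \<in> torus N d \<Longrightarrow> 1 - hit A b y \<le> \<beta>" "0 \<le> \<beta>"
  shows "1 - hit A (j * b) x \<le> \<beta> ^ j"
proof (induction j)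
  case 0
  thus ?case using hit_bounds[OF assms(1)] by simp
next
  case (Suc j)
  have "1 - hit A (j * b + b) x \<le> (1 - hit A (j * b) x) * \<beta>"
    by (rule avoid_add_le[OF assms])
  also have "\<dots> \<le> \<beta> ^ j * \<beta>" using Suc assms by (intro mult_right_mono)
  finally show ?case by (simp add: add.commute mult.commute)
qed

text \<open>Times up to \<open>m\<^sup>2\<close>, the diffusive time scale of the ball, count 1
  each. For later times the stationary part of the kernel bound sums to order
  \<open>K * m ^ d / N ^ d\<close>, hence \<open>m\<^sup>2\<close> by the assumption
  \<open>K\<close>, and the decaying part to order \<open>m ^ d / m ^ (d - 2)\<close>.\<close>

lemma visits_ball_le:
  assumes d: "d \<ge> 3" and m: "m \<ge> 1" and K: "real K * real m ^ (d - 2) \<le> real N ^ d" and w: "w \<in> torus N d"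
  shows "(\<Sum>k\<le>2*K. (lazy ^^ k) (indicator (torus_ball N d z m)) w) \<le> (2 + 4 * 3 ^ d * heat_const d) * real m ^ 2"
proof -
  let ?B = "torus_ball N d z m" and ?L = "\<lambda>k. (lazy ^^ k) (indicator (torus_ball N d z m)) w"
  let ?C = "(3 * real m) ^ d * heat_const d"
  have md: "real m ^ d = real m ^ (d - 2) * real m ^ 2"
    by (rule power_split_two) (use d in simp)
  have c: "real (card ?B) \<le> (3 * real m) ^ d"
  proof -
    have "real (card ?B) \<le> real ((2 * m + 1) ^ d)" using card_torus_ball_le by (simp only: of_nat_le_iff)
    also have "\<dots> = (1 + 2 * real m) ^ d" by simp
    also have "\<dots> \<le> (3 * real m) ^ d" using m by (intro power_mono) auto
    finally show ?thesis .
  qed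
  \<comment> \<open>The \<open>max\<close> keeps the split correct if
    \<open>2 * K < m ^ 2\<close>.\<close>
  have "(\<Sum>k\<le>2*K. ?L k) \<le> (\<Sum>k\<in>{..m^2} \<union> {m^2<..max (2*K) (m^2)}. ?L k)"
    using w by (intro sum_mono2) (auto intro: lazy_iter_indicator_nonneg)
  also have "\<dots> = (\<Sum>k\<le>m^2. ?L k) + (\<Sum>k\<in>{m^2<..max (2*K) (m^2)}. ?L k)"
    by (rule sum.union_disjoint) auto
  also have "(\<Sum>k\<le>m^2. ?L k) \<le> (\<Sum>k\<le>m^2. 1)"
    using w by (intro sum_mono lazy_iter_indicator_le_1)
  also have "\<dots> \<le> 2 * real m ^ 2" using m by simp
  also have "(\<Sum>k\<in>{m^2<..max (2*K) (m^2)}. ?L k) \<le>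
      (\<Sum>k\<in>{m^2<..max (2*K) (m^2)}. ?C * (1 / real N ^ d + 1 / sqrt (real k) ^ d))"
    by (intro sum_mono lazy_iter_indicator_le[OF w torus_ball_subset _ c]) auto
  also have "\<dots> = ?C * (real (card {m^2<..max (2*K) (m^2)}) / real N ^ d + (\<Sum>k\<in>{m^2<..max (2*K) (m^2)}. 1 / sqrt (real k) ^ d))"
    by (simp add: sum_distrib_left[symmetric] sum.distrib)
  also have "\<dots> \<le> ?C * (2 * real K / real N ^ d + 2 / real m ^ (d - 2))"
  proof (intro mult_left_mono add_mono)
    show "real (card {m^2<..max (2*K) (m^2)}) / real N ^ d \<le> 2 * real K / real N ^ d"
    proof (rule divide_right_mono)
      have "card {m^2<..max (2*K) (m^2)} \<le> 2 * K" by (simp add: max_def)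
      hence "real (card {m^2<..max (2*K) (m^2)}) \<le> real (2 * K)" by (simp only: of_nat_le_iff)
      thus "real (card {m^2<..max (2*K) (m^2)}) \<le> 2 * real K" by simp
    qed simp
    show "(\<Sum>k\<in>{m^2<..max (2*K) (m^2)}. 1 / sqrt (real k) ^ d) \<le> 2 / real m ^ (d - 2)"
      using sum_inverse_sqrt_power_le[of "m^2" "max (2*K) (m^2)" d] m d by simp
  qed (simp add: heat_const_nonneg)
  also have "\<dots> = 3 ^ d * heat_const d * real m ^ 2 * (2 * (real K * real m ^ (d - 2) / real N ^ d) + 2)"
    using m unfolding power_mult_distrib md by (simp add: field_simps)
  also have "\<dots> \<le> 3 ^ d * heat_const d * real m ^ 2 * (2 * 1 + 2)"
    using K N_pos by (intro mult_left_mono add_mono) (auto simp: heat_const_nonneg)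
  finally show ?thesis by (simp add: algebra_simps)
qed

text \<open>Only the times after \<open>K\<close> are counted: by then the walk is mixed, and each
  point has at least half its stationary weight.\<close>

lemma visits_ball_ge:
  assumes mK: "m < N" "real N ^ d * exp (- 4 * real K / (real d * real N ^ 2)) \<le> 1 / 2"
    and x: "x \<in> torus N d"
  shows "real K * real m ^ d / (2 * real N ^ d) \<le> (\<Sum>k\<le>2*K. (lazy ^^ k) (indicator (torus_ball N d z m)) x)"
proof -
  let ?B = "torus_ball N d z m" and ?L = "\<lambda>k. (lazy ^^ k) (indicator (torus_ball N d z m)) x"
  have ge: "real m ^ d / (2 * real N ^ d) \<le> ?L k" if k: "k > K" for k
  proof -
    have "real N ^ d * exp (- 4 * real k / (real d * real N ^ 2)) \<le> real N ^ d * exp (- 4 * real K / (real d * real N ^ 2))"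
      using k by (intro mult_left_mono) (auto intro!: divide_right_mono)
    hence mix: "real N ^ d * exp (- 4 * real k / (real d * real N ^ 2)) \<le> 1 / 2" using mK by linarith
    have "real m ^ d \<le> real ((m + 1) ^ d)" by (simp add: power_mono)
    also have "\<dots> \<le> real (card ?B)" using card_torus_ball_ge[OF mK(1)] by (simp only: of_nat_le_iff)
    finally have "real m ^ d / (2 * real N ^ d) \<le> real (card ?B) / (2 * real N ^ d)"
      by (intro divide_right_mono) auto
    also have "\<dots> = (\<Sum>w\<in>?B. 1 / (2 * real N ^ d))" by simp
    also have "\<dots> \<le> (\<Sum>w\<in>?B. (lazy ^^ k) (indicator {w}) x)"
      using torus_ball_subset by (intro sum_mono lazy_kernel_ge x mix) auto
    also have "\<dots> = ?L k" by (rule lazy_iter_indicator_sum[OF finite_torus_ball, symmetric])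
    finally show ?thesis .
  qed
  have "real K * real m ^ d / (2 * real N ^ d) = (\<Sum>k\<in>{K<..2*K}. real m ^ d / (2 * real N ^ d))" by simp
  also have "\<dots> \<le> (\<Sum>k\<in>{K<..2*K}. ?L k)" using ge by (intro sum_mono) auto
  also have "\<dots> \<le> (\<Sum>k\<le>2*K. ?L k)"
    using x by (intro sum_mono2) (auto intro: lazy_iter_indicator_nonneg)
  finally show ?thesis .
qed

text \<open>The expected number of visits from \<open>x\<close> is divided by its bound for starts
  in the ball; the quotient of \<open>m ^ d\<close> and \<open>m\<^sup>2\<close> produces
  \<open>m ^ (d - 2)\<close>.\<close>

lemma hit_ball_ge:
  assumes d: "d \<ge> 3" and m: "m \<ge> 1" "m < N" and K: "real K * real m ^ (d - 2) \<le> real N ^ d"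
    and mix: "real N ^ d * exp (- 4 * real K / (real d * real N ^ 2)) \<le> 1 / 2"
    and x: "x \<in> torus N d"
  shows "hit_const d * real K * real m ^ (d - 2) / real N ^ d \<le> hit (torus_ball N d z m) (2 * K) x"
proof -
  let ?M = "(2 + 4 * 3 ^ d * heat_const d) * real m ^ 2"
  have md: "real m ^ d = real m ^ (d - 2) * real m ^ 2"
    by (rule power_split_two) (use d in simp)
  have M: "0 < ?M" using m by (intro mult_pos_pos add_pos_nonneg) (auto simp: heat_const_nonneg)
  have "real K * real m ^ d / (2 * real N ^ d) \<le> ?M * hit (torus_ball N d z m) (2 * K) x"
  proof (rule order_trans[OF visits_ball_ge[OF m(2) mix x]])
    show "(\<Sum>k\<le>2*K. (lazy ^^ k) (indicator (torus_ball N d z m)) x) \<le> ?M * hit (torus_ball N d z m) (2 * K) x"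
      using M by (intro visits_le_hit[where ?n0.0 = "2 * K"] visits_ball_le[OF d m(1) K] x) auto
  qed
  hence "real K * real m ^ d / (2 * real N ^ d) / ?M \<le> hit (torus_ball N d z m) (2 * K) x"
    by (simp only: pos_divide_le_eq[OF M] mult.commute[of _ ?M])
  moreover have "real K * real m ^ d / (2 * real N ^ d) / ?M = hit_const d * real K * real m ^ (d - 2) / real N ^ d"
  proof -
    have "hit_const d = 1 / (2 * (2 + 4 * 3 ^ d * heat_const d))"
      by (simp add: hit_const_def algebra_simps)
    thus ?thesis using m unfolding md by simp
  qed
  ultimately show ?thesis by simp
qed

text \<open>The time is cut into \<open>T div (2 * K)\<close> blocks, in each of which the ball is
  hit with probability at least \<open>q\<close> from any position.\<close>

lemma walk_law_avoid_ball_le: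
  assumes d: "d \<ge> 3" and m: "m \<ge> 1" "m < N" and K: "real K * real m ^ (d - 2) \<le> real N ^ d"
    and mix: "real N ^ d * exp (- 4 * real K / (real d * real N ^ 2)) \<le> 1 / 2"
    and T: "4 * K \<le> T" "K > 0"
  shows "measure (walk_law N d) {\<omega> \<in> space (walk_law N d). \<forall>k\<le>T. \<omega> k \<notin> torus_ball N d z m}
    \<le> exp (- (hit_const d / 4) * real m ^ (d - 2) * real T / real N ^ d)"
proof (rule walk_law_avoid_le)
  fix x assume x: "x \<in> torus N d"
  let ?B = "torus_ball N d z m"
  define q where "q = hit_const d * real K * real m ^ (d - 2) / real N ^ d"
  define j where "j = T div (2 * K)"
  have q: "1 - hit ?B (2 * K) y \<le> 1 - q" if "y \<in> torus N d" for y
    using hit_ball_ge[OF d m K mix that, of z] by (simp add: q_def)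
  have q1: "0 \<le> 1 - q" using q[OF x] hit_bounds[OF x, of ?B "2 * K"] by linarith
  have q0: "0 \<le> q" using hit_const_pos[of d] by (simp add: q_def)
  have "j * (2 * K) + T mod (2 * K) = T" by (simp only: j_def div_mult_mod_eq)
  hence "1 - hit ?B T x = 1 - hit ?B (j * (2 * K) + T mod (2 * K)) x" by (simp only:)
  also have "\<dots> \<le> (1 - hit ?B (j * (2 * K)) x) * 1"
    using hit_bounds by (intro avoid_add_le x) auto
  also have "\<dots> \<le> (1 - q) ^ j" using avoid_power_le[OF x q q1] by simp
  also have "\<dots> \<le> exp (- q) ^ j" using q1 exp_ge_add_one_self[of "- q"] by (intro power_mono) auto
  also have "\<dots> = exp (- (q * real j))" by (simp add: exp_of_nat_mult[symmetric] mult.commute)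
  also have "\<dots> \<le> exp (- (q * (real T / (4 * real K))))"
  proof -
    \<comment> \<open>At least one block fits, so rounding down loses at most a factor 2.\<close>
    have "T < 2 * K * (j + 1)" using T dividend_less_times_div[of "2 * K" T] by (simp add: j_def algebra_simps)
    hence "T \<le> 4 * K * j" using T by (cases j) auto
    hence "real T \<le> real (4 * K * j)" by (simp only: of_nat_le_iff)
    hence "real T / (4 * real K) \<le> real j" using T by (simp add: field_simps)
    from mult_left_mono[OF this q0] show ?thesis by (simp only: exp_le_cancel_iff neg_le_iff_le)
  qed
  also have "q * (real T / (4 * real K)) = (hit_const d / 4) * real m ^ (d - 2) * real T / real N ^ d"
    using T by (simp add: q_def)
  finally show "1 - hit ?B T x \<le> exp (- (hit_const d / 4) * real m ^ (d - 2) * real T / real N ^ d)" by simp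
qed simp

end

section \<open>Lower bound: some ball is missed\<close>

text \<open>At least \<open>48 * 5 ^ d * heat_const d\<close>, which brings the Green function in
  \<open>cover_far_ball_le_half\<close> down to half of its lower bound on the target.\<close>

definition target_const :: "nat \<Rightarrow> real" where
  "target_const d = 64 * 5 ^ d * (heat_const d + 1)"

lemma target_const_pos: "0 < target_const d"
  by (simp add: target_const_def heat_const_nonneg add_nonneg_pos)

lemma exp_neg_double_le:
  fixes t :: real
  assumes "0 \<le> t" "t \<le> 1 / 2"
  shows "exp (- 2 * t) \<le> 1 - t"
proof -
  have "1 \<le> (1 + 2 * t) * (1 - t)" using assms mult_left_mono[of t "1 / 2" t] by (simp add: algebra_simps)
  also have "\<dots> \<le> exp (2 * t) * (1 - t)" using assms exp_ge_add_one_self[of "2 * t"] by (intro mult_right_mono) auto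
  finally show ?thesis by (simp add: exp_minus field_simps)
qed

section \<open>The Green function of the killed lazy walk\<close>

context torus_walk begin

text \<open>The expected number of visits to \<open>A\<close> of the lazy walk that survives each
  step with probability \<open>r\<close>.\<close>

definition green :: "real \<Rightarrow> (nat \<Rightarrow> int) set \<Rightarrow> (nat \<Rightarrow> int) \<Rightarrow> real" where
  "green r A x = (\<Sum>n. r ^ n * (lazy ^^ n) (indicator A) x)"

lemma lazy_sums:
  assumes "\<And>y. y \<in> torus N d \<Longrightarrow> (\<lambda>n. F n y) sums G y" "x \<in> torus N d"
  shows "(\<lambda>n. lazy (F n) x) sums lazy G x"
  unfolding lazy_def avg_def using assms
  by (intro sums_divide sums_add sums_sum) (auto intro: step_in_torus)

context
  fixes r :: real
  assumes r: "0 \<le> r" "r < 1"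
begin

lemma green_summable:
  assumes "x \<in> torus N d"
  shows "summable (\<lambda>n. r ^ n * (lazy ^^ n) (indicator A) x)"
proof (rule summable_comparison_test')
  show "summable (\<lambda>n. r ^ n)" using r by (intro summable_geometric) simp
  show "norm (r ^ n * (lazy ^^ n) (indicator A) x) \<le> r ^ n" if "n \<ge> 0" for n
    using lazy_iter_indicator_le_1[OF assms, of n A] lazy_iter_indicator_nonneg[OF assms, of n A] r
    by (simp add: abs_mult mult_left_le)
qed

lemma green_nonneg: "x \<in> torus N d \<Longrightarrow> 0 \<le> green r A x"
  unfolding green_def using r
  by (intro suminf_nonneg green_summable mult_nonneg_nonneg lazy_iter_indicator_nonneg) auto

lemma green_equation:
  assumes x: "x \<in> torus N d"
  shows "green r A x = indicator A x + r * lazy (green r A) x"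
proof -
  have "(\<lambda>n. lazy (\<lambda>y. r ^ n * (lazy ^^ n) (indicator A) y) x) sums lazy (green r A) x"
    unfolding green_def by (intro lazy_sums summable_sums green_summable x)
  hence "(\<lambda>n. r * lazy (\<lambda>y. r ^ n * (lazy ^^ n) (indicator A) y) x) sums (r * lazy (green r A) x)"
    by (rule sums_mult)
  hence "(\<lambda>n. r ^ Suc n * (lazy ^^ Suc n) (indicator A) x) sums (r * lazy (green r A) x)"
    by (simp add: lazy_cmult mult.assoc)
  from sums_unique[OF this] suminf_split_head[OF green_summable[OF x, of A]]
  show ?thesis by (simp add: green_def)
qed

text \<open>A supersolution for the lazy walk killed at rate \<open>1 - r\<close> is one for the walk itself killed at
  rate \<open>1 - r / (2 - r)\<close>.\<close>

lemma green_superharmonic: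
  assumes "x \<in> torus N d"
  shows "r / (2 - r) * avg (green r A) x \<le> green r A x"
proof -
  have "r * lazy (green r A) x \<le> green r A x"
    using green_equation[OF assms, of A] by (simp add: indicator_def)
  hence "r * avg (green r A) x \<le> (2 - r) * green r A x" by (simp add: lazy_def algebra_simps)
  thus ?thesis using r by (simp add: field_simps)
qed

text \<open>Doubling the radius leaves room \<open>m\<close> around every \<open>w\<close>. For
  about \<open>m\<^sup>2 / 2\<close> steps the walk survives with probability at least 1/2, by
  Bernoulli's inequality and \<open>rm\<close>, and is within \<open>m\<close> of \<open>w\<close>
  with probability at least 1/2, by Chebyshev, so each of these steps contributes 1/4.\<close>

lemma green_ball_ge:
  assumes w: "w \<in> torus_ball N d c m" and rm: "(1 - r) * real m ^ 2 \<le> 1 / 2"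
  shows "real m ^ 2 / 8 \<le> green r (torus_ball N d c (2 * m)) w"
proof -
  let ?b = "(m ^ 2 + 1) div 2" and ?B = "torus_ball N d c (2 * m)"
  have wt: "w \<in> torus N d" using w torus_ball_subset by blast
  have quarter: "1 / 4 \<le> r ^ n * (lazy ^^ n) (indicator ?B) w" if n: "n < ?b" for n
  proof -
    have "2 * n \<le> m ^ 2" using n by simp
    hence n2: "2 * real n \<le> real m ^ 2" by (metis of_nat_le_iff of_nat_mult of_nat_numeral of_nat_power)
    have "1 / 2 \<le> 1 + real n * (r - 1)"
    proof -
      have "(1 - r) * real n \<le> (1 - r) * real m ^ 2"
      proof (rule mult_left_mono)
        show "real n \<le> real m ^ 2" using n2 by linarith
      qed (use r in simp)
      thus ?thesis using rm by (simp add: algebra_simps)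
    qed
    also have "\<dots> \<le> r ^ n" using Bernoulli_inequality[of "r - 1" n] r by simp
    finally have a: "1 / 2 \<le> r ^ n" .
    have "2 * real n \<le> (real m + 1) ^ 2" using n2 by (simp add: power2_eq_square algebra_simps)
    hence "real n / (real m + 1) ^ 2 \<le> 1 / 2" by (simp add: field_simps add_nonneg_pos)
    hence "1 / 2 \<le> 1 - real n / (real m + 1) ^ 2" by simp
    also have "\<dots> \<le> (lazy ^^ n) (indicator (torus_ball N d w m)) w" by (rule lazy_iter_ball_ge[OF wt])
    also have "\<dots> \<le> (lazy ^^ n) (indicator ?B) w"
      by (intro lazy_iter_indicator_mono wt torus_ball_subset_double[OF w])
    finally have b: "1 / 2 \<le> (lazy ^^ n) (indicator ?B) w" .
    show ?thesis using mult_mono[OF a b] r by simp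
  qed
  have "m ^ 2 \<le> 2 * ?b" by simp
  hence "real (m ^ 2) \<le> real (2 * ?b)" by (simp only: of_nat_le_iff)
  hence "real m ^ 2 / 8 \<le> (\<Sum>n<?b. 1 / 4)" by simp
  also have "\<dots> \<le> (\<Sum>n<?b. r ^ n * (lazy ^^ n) (indicator ?B) w)" by (intro sum_mono quarter) simp
  also have "\<dots> \<le> green r ?B w" unfolding green_def
    using r wt by (intro sum_le_suminf green_summable) (auto intro!: mult_nonneg_nonneg lazy_iter_indicator_nonneg)
  finally show ?thesis .
qed

text \<open>Finite speed removes the terms up to \<open>Q\<close>. In the rest, killing makes the
  stationary part of the kernel summable, while the decaying part is summed as a tail from
  \<open>Q\<close>.\<close>

lemma green_ball_le:
  assumes x: "x \<in> torus N d" and far: "int (2 * m + Q) < cyc_dist N (c 0) (x 0)"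
    and Q: "Q > 0" and m: "m \<ge> 1" and d: "d \<ge> 3"
  shows "green r (torus_ball N d c (2 * m)) x \<le>
    (5 * real m) ^ d * heat_const d * (1 / ((1 - r) * real N ^ d) + 2 / sqrt (real Q) ^ (d - 2))"
proof -
  let ?B = "torus_ball N d c (2 * m)" and ?C = "(5 * real m) ^ d * heat_const d"
  have C: "0 \<le> ?C" by (simp add: heat_const_nonneg)
  have card: "real (card ?B) \<le> (5 * real m) ^ d"
  proof -
    have "real (card ?B) \<le> real ((2 * (2 * m) + 1) ^ d)" using card_torus_ball_le by (simp only: of_nat_le_iff)
    also have "\<dots> = (1 + 4 * real m) ^ d" by simp
    also have "\<dots> \<le> (5 * real m) ^ d" using m by (intro power_mono) auto
    finally show ?thesis .
  qed
  have "(\<Sum>n<b. r ^ n * (lazy ^^ n) (indicator ?B) x) \<le> ?C * (1 / ((1 - r) * real N ^ d) + 2 / sqrt (real Q) ^ (d - 2))" for b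
  proof -
    let ?I = "{Q<..max b Q}"
    have "(\<Sum>n<b. r ^ n * (lazy ^^ n) (indicator ?B) x) \<le> (\<Sum>n\<in>{..Q} \<union> ?I. r ^ n * (lazy ^^ n) (indicator ?B) x)"
      using x r by (intro sum_mono2) (auto intro!: mult_nonneg_nonneg lazy_iter_indicator_nonneg)
    also have "\<dots> = (\<Sum>n\<in>?I. r ^ n * (lazy ^^ n) (indicator ?B) x)"
    proof (rule sum.mono_neutral_right)
      have "(lazy ^^ n) (indicator ?B) x = 0" if "n \<le> Q" for n
        using lazy_iter_ball_far[OF x, of "2 * m" n c] far that by simp
      thus "\<forall>n\<in>{..Q} \<union> ?I - ?I. r ^ n * (lazy ^^ n) (indicator ?B) x = 0" by auto
    qed auto
    also have "\<dots> \<le> (\<Sum>n\<in>?I. ?C * (r ^ n * (1 / real N ^ d) + 1 / sqrt (real n) ^ d))"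
    proof (rule sum_mono)
      fix n assume n: "n \<in> ?I"
      have "r ^ n * (lazy ^^ n) (indicator ?B) x \<le> r ^ n * (?C * (1 / real N ^ d + 1 / sqrt (real n) ^ d))"
        using n r by (intro mult_left_mono lazy_iter_indicator_le[OF x torus_ball_subset _ card]) auto
      also have "\<dots> = ?C * (r ^ n * (1 / real N ^ d) + r ^ n * (1 / sqrt (real n) ^ d))"
        by (simp only: distrib_left mult.left_commute)
      also have "\<dots> \<le> ?C * (r ^ n * (1 / real N ^ d) + 1 * (1 / sqrt (real n) ^ d))"
        using r C by (intro mult_left_mono add_left_mono mult_right_mono) (auto simp: power_le_one)
      finally show "r ^ n * (lazy ^^ n) (indicator ?B) x \<le> ?C * (r ^ n * (1 / real N ^ d) + 1 / sqrt (real n) ^ d)"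
        by simp
    qed
    also have "\<dots> = ?C * ((\<Sum>n\<in>?I. r ^ n) * (1 / real N ^ d) + (\<Sum>n\<in>?I. 1 / sqrt (real n) ^ d))"
      by (simp only: sum_distrib_left[symmetric] sum.distrib sum_distrib_right[symmetric])
    also have "\<dots> \<le> ?C * (1 / (1 - r) * (1 / real N ^ d) + 2 / sqrt (real Q) ^ (d - 2))"
    proof (intro mult_left_mono add_mono mult_right_mono C)
      have "(\<Sum>n\<in>?I. r ^ n) \<le> (\<Sum>n. r ^ n)"
        using r by (intro sum_le_suminf summable_geometric) auto
      also have "\<dots> = 1 / (1 - r)" using r by (intro suminf_geometric) simp
      finally show "(\<Sum>n\<in>?I. r ^ n) \<le> 1 / (1 - r)" .
      show "(\<Sum>n\<in>?I. 1 / sqrt (real n) ^ d) \<le> 2 / sqrt (real Q) ^ (d - 2)"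
        using Q d by (intro sum_inverse_sqrt_power_le) auto
    qed simp
    finally show ?thesis by simp
  qed
  thus ?thesis unfolding green_def by (intro suminf_le_const green_summable x)
qed

end

text \<open>Maximum principle with the Green function of the doubled ball: it is at least
  \<open>m\<^sup>2 / 8\<close> on the target and at most \<open>m\<^sup>2 / 16\<close> at the
  distant point \<open>x\<close>.\<close>

lemma cover_far_ball_le_half:
  assumes d: "d \<ge> 3" and m: "m \<ge> 1" and Q: "Q > 0"
    and \<theta>: "\<theta> = target_const d * real m ^ (d - 2) / real N ^ d" "\<theta> * real m ^ 2 \<le> 1 / 2"
    and small: "target_const d * real m ^ (d - 2) \<le> sqrt (real Q) ^ (d - 2)"
    and x: "x \<in> torus N d" and far: "int (2 * m + Q) < cyc_dist N (c 0) (x 0)"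
    and T: "T j = torus_ball N d c m"
  shows "cover ((1 - \<theta>) / (1 + \<theta>)) T n {j} x \<le> 1 / 2"
proof -
  define r where "r = 1 - \<theta>"
  let ?f = "green r (torus_ball N d c (2 * m))"
  have th0: "0 < \<theta>" using \<theta>(1) m N_pos target_const_pos[of d] by simp
  have "\<theta> * 1 \<le> \<theta> * real m ^ 2" using th0 m by (intro mult_left_mono) auto
  hence "\<theta> \<le> 1 / 2" using \<theta>(2) by linarith
  hence r: "0 \<le> r" "r < 1" using th0 by (simp_all add: r_def)
  have p: "(1 - \<theta>) / (1 + \<theta>) = r / (2 - r)" by (simp add: r_def)
  have "real m ^ 2 / 8 * cover ((1 - \<theta>) / (1 + \<theta>)) T n {j} x \<le> ?f x"
    unfolding p
  proof (rule cover_single_le[OF _ _ x])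
    show "0 \<le> r / (2 - r)" using r by simp
    show "r / (2 - r) * avg ?f y \<le> ?f y" if "y \<in> torus N d" for y
      by (rule green_superharmonic[OF r that])
    show "real m ^ 2 / 8 \<le> ?f y" if "y \<in> T j" for y
      using that green_ball_ge[OF r] \<theta>(2) T by (simp add: r_def)
  qed (use green_nonneg[OF r] in auto)
  also have "?f x \<le> real m ^ 2 / 16"
  proof -
    have "?f x \<le> (5 * real m) ^ d * heat_const d * (1 / ((1 - r) * real N ^ d) + 2 / sqrt (real Q) ^ (d - 2))"
      using green_ball_le[OF r x, of m Q c] far Q m d by blast
    \<comment> \<open>With this choice of \<theta> the stationary term takes the same form as the
      bound that \<open>small\<close> gives for the tail.\<close>
    also have "(1 - r) * real N ^ d = target_const d * real m ^ (d - 2)"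
      using N_pos by (simp add: r_def \<theta>(1))
    also have "(5 * real m) ^ d * heat_const d * (1 / (target_const d * real m ^ (d - 2)) + 2 / sqrt (real Q) ^ (d - 2))
      \<le> (5 * real m) ^ d * heat_const d * (1 / (target_const d * real m ^ (d - 2)) + 2 / (target_const d * real m ^ (d - 2)))"
      using small target_const_pos[of d] m Q
      by (intro mult_left_mono add_left_mono divide_left_mono mult_nonneg_nonneg heat_const_nonneg mult_pos_pos) auto
    also have "\<dots> = 3 * (5 ^ d * heat_const d) * real m ^ 2 / target_const d"
    proof -
      have "(5 * real m) ^ d = 5 ^ d * (real m ^ (d - 2) * real m ^ 2)"
        unfolding power_mult_distrib by (subst power_split_two[of d "real m"]) (use d in auto)
      thus ?thesis using m target_const_pos[of d] by (simp add: field_simps)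
    qed
    also have "\<dots> \<le> real m ^ 2 / 16"
    proof -
      have "48 * (5 ^ d * heat_const d) \<le> target_const d"
        by (simp add: target_const_def algebra_simps heat_const_nonneg add_nonneg_nonneg)
      hence "48 * (5 ^ d * heat_const d) * real m ^ 2 \<le> target_const d * real m ^ 2"
        by (rule mult_right_mono) simp
      thus ?thesis using target_const_pos[of d] by (simp add: field_simps)
    qed
    finally show ?thesis .
  qed
  finally show ?thesis using m by (simp add: field_simps)
qed

section \<open>Equally spaced centers on a coordinate axis\<close>

definition center :: "nat \<Rightarrow> nat \<Rightarrow> nat \<Rightarrow> int" where
  "center q j = (\<lambda>i\<in>{..<d}. if i = 0 then int (j * q) else 0)"

lemma center_0: "center q j 0 = int (j * q)"
  using d_pos by (simp add: center_def)

lemma center_in_torus: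
  assumes "q * q \<le> N" "j < q"
  shows "center q j \<in> torus N d"
proof -
  have "j * q < q * q" using assms by simp
  hence "int (j * q) < int N" using assms by linarith
  thus ?thesis using N_pos by (auto simp: center_def torus_def)
qed

text \<open>In absolute value, the first coordinates differ by at least \<open>q\<close> and at most
  \<open>(q - 1) * q\<close>; as \<open>q * q \<le> N\<close>, the way around the torus also has
  length at least \<open>q\<close>.\<close>

lemma cyc_dist_center_ge:
  assumes q: "q * q \<le> N" and ij: "i < q" "j < q" "i \<noteq> j"
  shows "int q \<le> cyc_dist N (center q i 0) (center q j 0)"
proof -
  obtain k where k: "cyc_dist N (center q i 0) (center q j 0) = \<bar>int (i * q) - int (j * q) + k * int N\<bar>"
    using cyc_dist_attained[OF N_pos, of "center q i 0" "center q j 0"] unfolding center_0 by metis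
  define t where "t = int i - int j"
  have t: "1 \<le> \<bar>t\<bar>" "\<bar>t\<bar> \<le> int q - 1" using ij by (auto simp: t_def)
  have e: "int (i * q) - int (j * q) = t * int q" by (simp add: t_def algebra_simps)
  have abs: "\<bar>t * int q\<bar> = \<bar>t\<bar> * int q" by (simp add: abs_mult)
  have lo: "int q \<le> \<bar>t * int q\<bar>" unfolding abs using mult_right_mono[OF t(1), of "int q"] by simp
  have hi: "\<bar>t * int q\<bar> \<le> int N - int q"
  proof -
    have "\<bar>t\<bar> * int q \<le> (int q - 1) * int q" by (rule mult_right_mono[OF t(2)]) simp
    moreover have "int (q * q) \<le> int N" using q by (simp only: of_nat_le_iff)
    ultimately show ?thesis unfolding abs by (simp add: algebra_simps)
  qed
  show ?thesis
  proof (cases "k = 0")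
    case True
    thus ?thesis using lo unfolding k e by simp
  next
    case False
    have "int N \<le> \<bar>k * int N\<bar>"
      using False mult_right_mono[of 1 "\<bar>k\<bar>" "int N"] by (simp add: abs_mult)
    thus ?thesis using hi unfolding k e by linarith
  qed
qed

text \<open>Matthews' bound holds for the discounted cover time. Up to time \<open>T\<close> the
  discount is at least \<open>p ^ T\<close>, and \<open>p \<ge> exp (- 3 * \<theta>)\<close> turns
  its removal into the exponential factor.\<close>

lemma walk_law_cover_balls_le:
  assumes d: "d \<ge> 3" and m: "m \<ge> 1" and Q: "Q > 0" "3 * m + Q < q" and q: "q * q \<le> N"
    and \<theta>: "\<theta> = target_const d * real m ^ (d - 2) / real N ^ d" "\<theta> * real m ^ 2 \<le> 1 / 2"
    and small: "target_const d * real m ^ (d - 2) \<le> sqrt (real Q) ^ (d - 2)"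
  shows "measure (walk_law N d) {\<omega> \<in> space (walk_law N d). \<forall>j\<in>{..<q}. \<exists>k\<le>T. \<omega> k \<in> torus_ball N d (center q j) m}
    \<le> 2 * exp (3 * \<theta> * real T) / real q"
proof -
  \<comment> \<open>Matthews' bound asks for disjointness over the whole index type, so indices from
    \<open>q\<close> on get the empty target.\<close>
  define B where "B j = (if j < q then torus_ball N d (center q j) m else {})" for j
  define p where "p = (1 - \<theta>) / (1 + \<theta>)"
  have th0: "0 < \<theta>" using \<theta>(1) m N_pos target_const_pos[of d] by simp
  have "\<theta> * 1 \<le> \<theta> * real m ^ 2" using th0 m by (intro mult_left_mono) auto
  hence th1: "\<theta> \<le> 1 / 2" using \<theta>(2) by linarith
  have p: "0 < p" "p \<le> 1" using th0 th1 by (simp_all add: p_def)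
  have pe: "exp (- 3 * \<theta>) \<le> p"
  proof -
    have "exp (- 3 * \<theta>) = exp (- 2 * \<theta>) * exp (- \<theta>)" by (simp flip: exp_add)
    also have "\<dots> \<le> (1 - \<theta>) * (1 / (1 + \<theta>))"
    proof (rule mult_mono)
      show "exp (- 2 * \<theta>) \<le> 1 - \<theta>" using exp_neg_double_le th0 th1 by simp
      show "exp (- \<theta>) \<le> 1 / (1 + \<theta>)" using exp_ge_add_one_self[of \<theta>] th0 by (simp add: exp_minus field_simps)
    qed (use th1 in auto)
    finally show ?thesis by (simp add: p_def)
  qed
  \<comment> \<open>A point of one ball is at distance at least \<open>q - m\<close>, hence more
    than \<open>2 * m + Q\<close>, from the other centers. This is what the doubled balls of the
    Green function estimate require.\<close>
  have apart: "int q \<le> int m + cyc_dist N (center q j 0) (x 0)"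
    if "i < q" "j < q" "i \<noteq> j" "x \<in> torus_ball N d (center q i) m" for i j x
  proof -
    have "cyc_dist N (center q i 0) (x 0) \<le> int m" using that d_pos by (auto simp: in_torus_ball_iff)
    moreover have "int q \<le> cyc_dist N (center q i 0) (center q j 0)"
      by (rule cyc_dist_center_ge[OF q that(1-3)])
    ultimately show ?thesis
      using cyc_dist_triangle[OF N_pos, of "center q i 0" "center q j 0" "x 0"] cyc_dist_commute[of N "x 0" "center q j 0"]
      by linarith
  qed
  have disj: "B i \<inter> B j = {}" if "i \<noteq> j" for i j
  proof (rule ccontr)
    assume "B i \<inter> B j \<noteq> {}"
    then obtain x where x: "x \<in> B i" "x \<in> B j" by auto
    hence ij: "i < q" "j < q" by (auto simp: B_def split: if_splits)
    hence "cyc_dist N (center q j 0) (x 0) \<le> int m" using x d_pos by (auto simp: B_def in_torus_ball_iff)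
    moreover have "x \<in> torus_ball N d (center q i) m" using x ij by (simp add: B_def)
    from apart[OF ij that this] have "int q \<le> int m + cyc_dist N (center q j 0) (x 0)" .
    ultimately have "int q \<le> int (2 * m)" by simp
    thus False using Q by simp
  qed
  have half: "cover p B n {j} x \<le> 1 / 2"
    if "x \<in> torus N d" "i \<in> {..<q}" "j \<in> {..<q}" "i \<noteq> j" "x \<in> B i" for n i j x
    unfolding p_def
  proof (rule cover_far_ball_le_half[OF d m Q(1) \<theta> small that(1)])
    show "int (2 * m + Q) < cyc_dist N (center q j 0) (x 0)"
      using apart[of i j x] that Q(2) by (simp add: B_def)
    show "B j = torus_ball N d (center q j) m" using that by (simp add: B_def)
  qed
  have le: "cover 1 B T {..<q} x \<le> 2 * exp (3 * \<theta> * real T) / real q" if x: "x \<in> torus N d" for x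
  proof -
    have q0: "q > 0" using Q by simp
    have "exp (- 3 * \<theta>) ^ T * cover 1 B T {..<q} x \<le> p ^ T * cover 1 B T {..<q} x"
      using cover_bounds[of 1 x B T "{..<q}"] x by (intro mult_right_mono power_mono pe) auto
    also have "\<dots> \<le> cover p B T {..<q} x" using p x by (intro cover_discount) auto
    also have "\<dots> \<le> 2 / (real (card {..<q}) + 1)"
      using p by (intro matthews_bound disj half x) auto
    also have "\<dots> \<le> 2 / real q" using q0 by (simp add: field_simps)
    finally have "exp (- (3 * \<theta> * real T)) * cover 1 B T {..<q} x \<le> 2 / real q"
      by (simp add: exp_of_nat_mult[symmetric] mult_ac)
    thus ?thesis using q0 by (simp add: exp_minus field_simps)
  qed
  have "measure (walk_law N d) {\<omega> \<in> space (walk_law N d). \<forall>j\<in>{..<q}. \<exists>k\<le>T. \<omega> k \<in> B j} \<le> 2 * exp (3 * \<theta> * real T) / real q"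
    by (intro walk_law_covered_le le) auto
  thus ?thesis by (simp add: B_def)
qed

end

section \<open>The largest vacant ball\<close>

context torus_walk begin

lemma cyc_dist_less: "cyc_dist N a b < int N"
  using N_pos by (simp add: cyc_dist_def min_less_iff_disj)

lemma visited_disjoint_iff: "0 \<le> t \<Longrightarrow> visited \<omega> t \<inter> B = {} \<longleftrightarrow> (\<forall>k\<le>nat \<lfloor>t\<rfloor>. \<omega> k \<notin> B)"
proof -
  assume "0 \<le> t"
  hence "real n \<le> t \<longleftrightarrow> n \<le> nat \<lfloor>t\<rfloor>" for n by (simp add: le_nat_iff le_floor_iff)
  thus ?thesis by (auto simp: visited_def)
qed

context
  fixes \<omega> :: "nat \<Rightarrow> nat \<Rightarrow> int" and t :: real
  assumes \<omega>: "\<omega> \<in> space (walk_law N d)" and t: "0 \<le> t"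
begin

text \<open>A ball of radius \<open>N\<close> or more is the whole torus and contains
  \<open>\<omega> 0\<close>. This bounds the vacant radii, so that their supremum is a
  maximum.\<close>

lemma vacant_radius_less:
  assumes "\<forall>k\<le>nat \<lfloor>t\<rfloor>. \<omega> k \<notin> torus_ball N d x m"
  shows "m < N"
proof (rule ccontr)
  assume "\<not> m < N"
  hence "cyc_dist N a b \<le> int m" for a b using cyc_dist_less[of a b] by linarith
  hence "\<omega> 0 \<in> torus_ball N d x m" using \<omega> by (simp add: in_torus_ball_iff space_walk_law)
  thus False using assms by auto
qed

text \<open>The vacant radii form a finite set closed downwards. For \<open>m > 0\<close> the value
  0 for the empty set cannot interfere.\<close>

lemma le_L_hat_iff:
  assumes "m > 0"
  shows "m \<le> L_hat N d \<omega> t \<longleftrightarrow> (\<exists>x\<in>torus N d. \<forall>k\<le>nat \<lfloor>t\<rfloor>. \<omega> k \<notin> torus_ball N d x m)"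
proof -
  define V where "V = {m. \<exists>x\<in>torus N d. \<forall>k\<le>nat \<lfloor>t\<rfloor>. \<omega> k \<notin> torus_ball N d x m}"
  have "V \<subseteq> {..<N}" using vacant_radius_less by (auto simp: V_def)
  hence fin: "finite V" by (rule finite_subset) simp
  have L: "L_hat N d \<omega> t = (if V = {} then 0 else Max V)"
    unfolding L_hat_def visited_disjoint_iff[OF t] V_def[symmetric] by (simp add: Sup_nat_def)
  have "m \<in> V" if le: "m \<le> L_hat N d \<omega> t"
  proof -
    have ne: "V \<noteq> {}" using le assms L by auto
    hence "Max V \<in> V" "m \<le> Max V" using Max_in[OF fin] le L by auto
    thus ?thesis using torus_ball_mono[of m "Max V"] by (fastforce simp: V_def)
  qed
  moreover have "m \<le> L_hat N d \<omega> t" if "m \<in> V" using Max_ge[OF fin that] that L by auto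
  ultimately show ?thesis by (auto simp: V_def)
qed

end

lemma prob_space_law: "prob_space (walk_law N d)"
  by (rule prob_space_walk_law[OF N_pos d_pos])

lemma sets_L_hat: "{\<omega> \<in> space (walk_law N d). P (L_hat N d \<omega> t)} \<in> sets (walk_law N d)"
  using measurable_compose[OF measurable_L_hat[of N d t], of P "count_space UNIV"]
  by (simp add: pred_def)

text \<open>Union bound over the \<open>N ^ d\<close> centers.\<close>

lemma prob_L_hat_ge_le:
  assumes d: "d \<ge> 3" and m: "m \<ge> 1" "m < N" and K: "real K * real m ^ (d - 2) \<le> real N ^ d"
    and mix: "real N ^ d * exp (- 4 * real K / (real d * real N ^ 2)) \<le> 1 / 2"
    and T: "4 * K \<le> nat \<lfloor>t\<rfloor>" "K > 0" and t: "0 \<le> t"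
  shows "measure (walk_law N d) {\<omega> \<in> space (walk_law N d). m \<le> L_hat N d \<omega> t}
    \<le> real N ^ d * exp (- (hit_const d / 4) * real m ^ (d - 2) * real (nat \<lfloor>t\<rfloor>) / real N ^ d)"
proof -
  interpret prob_space "walk_law N d" by (rule prob_space_law)
  let ?A = "\<lambda>x. {\<omega> \<in> space (walk_law N d). \<forall>k\<le>nat \<lfloor>t\<rfloor>. \<omega> k \<notin> torus_ball N d x m}"
  have A: "?A x \<in> sets (walk_law N d)" for x by measurable
  have "{\<omega> \<in> space (walk_law N d). m \<le> L_hat N d \<omega> t} \<subseteq> (\<Union>x\<in>torus N d. ?A x)"
    using m le_L_hat_iff[OF _ t, of _ m] by auto
  hence "prob {\<omega> \<in> space (walk_law N d). m \<le> L_hat N d \<omega> t} \<le> prob (\<Union>x\<in>torus N d. ?A x)"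
    by (intro finite_measure_mono sets.finite_UN finite_torus A)
  also have "\<dots> \<le> (\<Sum>x\<in>torus N d. prob (?A x))"
    using A by (intro finite_measure_subadditive_finite finite_torus) auto
  also have "\<dots> \<le> (\<Sum>x\<in>torus N d. exp (- (hit_const d / 4) * real m ^ (d - 2) * real (nat \<lfloor>t\<rfloor>) / real N ^ d))"
    by (intro sum_mono walk_law_avoid_ball_le[OF d m K mix T])
  finally show ?thesis by (simp add: card_torus)
qed

text \<open>If no ball of radius \<open>m\<close> is vacant, then in particular the walk meets all
  \<open>q\<close> balls around the chosen centers.\<close>

lemma prob_L_hat_less_le:
  assumes d: "d \<ge> 3" and m: "m \<ge> 1" and Q: "Q > 0" "3 * m + Q < q" and q: "q * q \<le> N"
    and \<theta>: "\<theta> = target_const d * real m ^ (d - 2) / real N ^ d" "\<theta> * real m ^ 2 \<le> 1 / 2"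
    and small: "target_const d * real m ^ (d - 2) \<le> sqrt (real Q) ^ (d - 2)" and t: "0 \<le> t"
  shows "measure (walk_law N d) {\<omega> \<in> space (walk_law N d). L_hat N d \<omega> t < m}
    \<le> 2 * exp (3 * \<theta> * real (nat \<lfloor>t\<rfloor>)) / real q"
proof -
  interpret prob_space "walk_law N d" by (rule prob_space_law)
  let ?A = "{\<omega> \<in> space (walk_law N d). \<forall>j\<in>{..<q}. \<exists>k\<le>nat \<lfloor>t\<rfloor>. \<omega> k \<in> torus_ball N d (center q j) m}"
  have "{\<omega> \<in> space (walk_law N d). L_hat N d \<omega> t < m} \<subseteq> ?A"
    using m le_L_hat_iff[OF _ t, of _ m] center_in_torus[OF q] by (fastforce simp: not_le[symmetric])
  moreover have "?A \<in> sets (walk_law N d)" by measurable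
  ultimately have "prob {\<omega> \<in> space (walk_law N d). L_hat N d \<omega> t < m} \<le> prob ?A"
    by (rule finite_measure_mono)
  also have "\<dots> \<le> 2 * exp (3 * \<theta> * real (nat \<lfloor>t\<rfloor>)) / real q"
    by (rule walk_law_cover_balls_le[OF d m Q q \<theta> small])
  finally show ?thesis .
qed

lemma prob_L_hat_between_ge:
  assumes "0 \<le> r1" "0 \<le> r2"
    and e1: "measure (walk_law N d) {\<omega> \<in> space (walk_law N d). nat r1 + 1 \<le> L_hat N d \<omega> t} \<le> e1"
    and e2: "measure (walk_law N d) {\<omega> \<in> space (walk_law N d). L_hat N d \<omega> t < nat r2} \<le> e2"
  shows "1 - (e1 + e2) \<le> measure (walk_law N d)
    {\<omega> \<in> space (walk_law N d). r2 \<le> int (L_hat N d \<omega> t) \<and> int (L_hat N d \<omega> t) \<le> r1}"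
proof -
  interpret prob_space "walk_law N d" by (rule prob_space_law)
  let ?S = "\<lambda>P. {\<omega> \<in> space (walk_law N d). P (L_hat N d \<omega> t)}"
  let ?G = "?S (\<lambda>L. r2 \<le> int L \<and> int L \<le> r1)" and ?U = "?S (\<lambda>L. nat r1 + 1 \<le> L)" and ?D = "?S (\<lambda>L. L < nat r2)"
  have "1 - prob ?G = prob (space (walk_law N d) - ?G)" by (rule prob_compl[OF sets_L_hat, symmetric])
  also have "\<dots> \<le> prob (?U \<union> ?D)"
    using assms(1,2) by (intro finite_measure_mono sets.Un sets_L_hat) auto
  also have "\<dots> \<le> prob ?U + prob ?D" by (intro measure_Un_le sets_L_hat)
  finally show ?thesis using e1 e2 by linarith
qed

end

section \<open>Choice of the scales for large \<open>N\<close>\<close>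

lemma powr_inverse_power:
  assumes "x > 0" "n > 0"
  shows "(x powr (1 / real n)) ^ n = x"
  using assms by (simp flip: powr_realpow add: powr_powr)

text \<open>With \<open>m\<close> just above the radius, \<open>m ^ (d - 2)\<close> lies between
  \<open>c ^ (d - 2) * ln N / u\<close> and \<open>b * ln N\<close>. The second condition on
  \<open>c\<close> makes the probability of missing a given ball at most \<open>N\<close> to the
  power \<open>- (d + 1)\<close>, which beats the \<open>N ^ d\<close> centers.\<close>

lemma eventually_prob_L_hat_gt:
  fixes u c :: real
  assumes d: "d \<ge> 3" and u: "u > 0" and c: "c \<ge> 1" "8 * (real d + 1) / hit_const d \<le> c"
  shows "\<forall>\<^sub>F N in sequentially. measure (walk_law N d)
    {\<omega> \<in> space (walk_law N d). nat (radius d c N u) + 1 \<le> L_hat N d \<omega> (u * real N ^ d)} \<le> 1 / real N"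
proof -
  define b where "b = (2 * c) ^ (d - 2) / u"
  have b: "b > 0" using c u by (simp add: b_def)
  have ev1: "\<forall>\<^sub>F N::nat in sequentially. b * ln (real N) < real N" using b by real_asymp
  have ev2: "\<forall>\<^sub>F N::nat in sequentially. real N powr (5/2) * (b * ln (real N)) \<le> real N ^ 3" using b by real_asymp
  have ev3: "\<forall>\<^sub>F N::nat in sequentially. 4 * real N powr (5/2) + 1 \<le> u * real N ^ 3" using u by real_asymp
  have dpos: "real d > 0" using d by simp
  have "\<forall>\<^sub>F N::nat in sequentially. real N powr D * exp (- 4 * (real N powr (5/2) - 1) / (D * real N ^ 2)) \<le> 1 / 2"
    if "D > 0" for D :: real
    using that by real_asymp
  note ev4 = this[OF dpos]
  have ev5: "\<forall>\<^sub>F N::nat in sequentially. ln (real N) \<ge> u" by real_asymp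
  have ev6: "\<forall>\<^sub>F N::nat in sequentially. u * real N ^ 3 \<ge> 2" using u by real_asymp
  show ?thesis
    using ev1 ev2 ev3 ev4 ev5 ev6 eventually_ge_at_top[of 2]
  proof eventually_elim
    case (elim N)
    interpret torus_walk N d by unfold_locales (use elim d in auto)
    define R where "R = (ln (real N) / u) powr (1 / real (d - 2))"
    have lnN: "ln (real N) > 0" using elim by simp
    have Rpow: "R ^ (d - 2) = ln (real N) / u" unfolding R_def using lnN u d by (intro powr_inverse_power) auto
    have R1: "R \<ge> 1" unfolding R_def using elim u lnN by (intro ge_one_powr_ge_zero) auto
    define m where "m = nat (radius d c N u) + 1"
    have "real d - 2 = real (d - 2)" using d by simp
    hence rad: "radius d c N u = \<lfloor>c * R\<rfloor>" unfolding radius_def R_def by (simp only:)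
    have cR: "1 \<le> c * R" using mult_mono[OF c(1) R1] c by simp
    have m_ge: "c * R \<le> real m" and m_le: "real m \<le> 2 * c * R"
    proof -
      have "real m = of_int \<lfloor>c * R\<rfloor> + 1" using cR by (simp add: m_def rad)
      thus "c * R \<le> real m" "real m \<le> 2 * c * R" using cR by linarith+
    qed
    have m1: "m \<ge> 1" by (simp add: m_def)
    have mpow: "real m ^ (d - 2) \<le> b * ln (real N)"
    proof -
      have "real m ^ (d - 2) \<le> (2 * c * R) ^ (d - 2)" using m_le by (intro power_mono) auto
      also have "\<dots> = b * ln (real N)" unfolding power_mult_distrib Rpow b_def by simp
      finally show ?thesis .
    qed
    have mN: "m < N"
    proof -
      have "real m \<le> real m ^ (d - 2)" using m1 d by (intro self_le_power) auto
      also have "\<dots> < real N" using mpow elim by linarith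
      finally show ?thesis by simp
    qed
    \<comment> \<open>The exponent 5/2 lies strictly between 2, the exponent of the mixing time up
      to a logarithm, and 3, which is at most \<open>d\<close>.\<close>
    define K where "K = nat \<lfloor>real N powr (5/2)\<rfloor>"
    have N52: "1 \<le> real N powr (5/2)" using elim by (intro ge_one_powr_ge_zero) auto
    have K: "real K \<le> real N powr (5/2)" "real N powr (5/2) - 1 \<le> real K" "K > 0"
      using N52 by (auto simp: K_def)
    have N3: "real N ^ 3 \<le> real N ^ d" using d elim by (intro power_increasing) auto
    have uN: "u * real N ^ 3 \<le> u * real N ^ d" using N3 u by (intro mult_left_mono) auto
    have Km: "real K * real m ^ (d - 2) \<le> real N ^ d"
    proof -
      have "real K * real m ^ (d - 2) \<le> real N powr (5/2) * (b * ln (real N))"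
        using K mpow by (intro mult_mono) auto
      thus ?thesis using elim N3 by linarith
    qed
    have mix: "real N ^ d * exp (- 4 * real K / (real d * real N ^ 2)) \<le> 1 / 2"
    proof -
      have "exp (- 4 * real K / (real d * real N ^ 2)) \<le> exp (- 4 * (real N powr (5/2) - 1) / (real d * real N ^ 2))"
        unfolding exp_le_cancel_iff using K by (intro divide_right_mono) auto
      hence "real N ^ d * exp (- 4 * real K / (real d * real N ^ 2)) \<le>
          real N ^ d * exp (- 4 * (real N powr (5/2) - 1) / (real d * real N ^ 2))"
        by (intro mult_left_mono) auto
      also have "\<dots> = real N powr real d * exp (- 4 * (real N powr (5/2) - 1) / (real d * real N ^ 2))"
        using elim by (simp add: powr_realpow)
      also note elim(4)
      finally show ?thesis .
    qed
    define T where "T = nat \<lfloor>u * real N ^ d\<rfloor>"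
    have t0: "0 \<le> u * real N ^ d" using u by simp
    have T: "u * real N ^ d - 1 \<le> real T" using t0 unfolding T_def by linarith
    have KT: "4 * K \<le> nat \<lfloor>u * real N ^ d\<rfloor>"
    proof -
      have "real (4 * K) \<le> u * real N ^ d" using K elim uN by simp
      thus ?thesis by (simp add: le_nat_floor)
    qed
    have "measure (walk_law N d) {\<omega> \<in> space (walk_law N d). m \<le> L_hat N d \<omega> (u * real N ^ d)}
      \<le> real N ^ d * exp (- (hit_const d / 4) * real m ^ (d - 2) * real T / real N ^ d)"
      unfolding T_def by (rule prob_L_hat_ge_le[OF d m1 mN Km mix KT K(3) t0])
    also have "\<dots> \<le> real N ^ d * exp (- (real d + 1) * ln (real N))"
    proof -
      have "(real d + 1) * ln (real N) \<le> (hit_const d / 8) * c * ln (real N)"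
        using c(2) lnN hit_const_pos[of d] by (intro mult_right_mono) (auto simp: field_simps)
      also have "\<dots> \<le> (hit_const d / 8) * c ^ (d - 2) * ln (real N)"
        using c lnN hit_const_pos[of d] d by (intro mult_right_mono mult_left_mono self_le_power) auto
      also have "\<dots> = (hit_const d / 8) * (c * R) ^ (d - 2) * u"
        unfolding power_mult_distrib Rpow using u by simp
      also have "\<dots> \<le> (hit_const d / 8) * real m ^ (d - 2) * u"
        using hit_const_pos[of d] m_ge cR u by (intro mult_right_mono mult_left_mono power_mono) auto
      also have "\<dots> = (hit_const d / 4) * real m ^ (d - 2) * (u * real N ^ d / 2) / real N ^ d"
        using elim by simp
      \<comment> \<open>Rounding: \<open>T\<close> is at least half of \<open>u * N ^ d\<close> once
        the latter is at least 2.\<close>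
      also have "\<dots> \<le> (hit_const d / 4) * real m ^ (d - 2) * real T / real N ^ d"
        using hit_const_pos[of d] T elim uN by (intro divide_right_mono mult_left_mono) auto
      finally have "- (hit_const d / 4) * real m ^ (d - 2) * real T / real N ^ d \<le> - (real d + 1) * ln (real N)"
        by (simp only: mult_minus_left divide_minus_left neg_le_iff_le)
      thus ?thesis by (intro mult_left_mono) auto
    qed
    also have "\<dots> = 1 / real N"
    proof -
      have "exp (- (real d + 1) * ln (real N)) = real N powr (- (real d + 1))"
        using elim by (simp add: powr_def)
      also have "\<dots> = 1 / (real N powr real d * real N powr 1)"
        by (simp only: powr_minus powr_add) (simp add: field_simps)
      also have "\<dots> = 1 / (real N ^ d * real N)" using elim by (simp add: powr_realpow)
      finally show ?thesis using elim by simp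
    qed
    finally show ?case by (simp add: m_def)
  qed
qed

text \<open>With about \<open>sqrt N\<close> balls, removing the killing costs at most
  \<open>exp (3 * target_const d * c ^ (d - 2) * ln N)\<close>. The last condition on
  \<open>c\<close> bounds this by \<open>N powr (1 / 4)\<close>, against a gain of order
  \<open>sqrt N\<close> from Matthews' bound.\<close>

lemma eventually_prob_L_hat_less:
  fixes u c :: real
  assumes d: "d \<ge> 3" and u: "u > 0" and c: "0 < c" "c \<le> 1" "c \<le> 1 / (12 * target_const d)"
  shows "\<forall>\<^sub>F N in sequentially. measure (walk_law N d)
    {\<omega> \<in> space (walk_law N d). L_hat N d \<omega> (u * real N ^ d) < nat (radius d c N u)} \<le> 4 * real N powr (- 1 / 4)"
proof -
  define b where "b = c ^ (d - 2) / u"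
  define A where "A = target_const d"
  have b: "b > 0" using c u by (simp add: b_def)
  have A: "A > 0" by (simp add: A_def target_const_pos)
  have ev1: "\<forall>\<^sub>F N::nat in sequentially. 3 * (b * ln (real N)) + sqrt (real N) / 3 < sqrt (real N) - 1"
    using b by real_asymp
  have ev2: "\<forall>\<^sub>F N::nat in sequentially. sqrt (real N) / 3 \<ge> 1" by real_asymp
  have ev3: "\<forall>\<^sub>F N::nat in sequentially. A * (b * ln (real N)) ^ 3 \<le> real N ^ 3 / 2" using A b by real_asymp
  have ev4: "\<forall>\<^sub>F N::nat in sequentially. (A * (b * ln (real N)))\<^sup>2 \<le> sqrt (real N) / 3 - 1" using A b by real_asymp
  \<comment> \<open>Ensures \<open>c * R \<ge> 1\<close> below, hence a target radius of at least
    1.\<close>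
  have ev5: "\<forall>\<^sub>F N::nat in sequentially. ln (real N) \<ge> u * (1 / c) ^ (d - 2)" by real_asymp
  have ev6: "\<forall>\<^sub>F N::nat in sequentially. sqrt (real N) - 1 \<ge> sqrt (real N) / 2" by real_asymp
  show ?thesis
    using ev1 ev2 ev3 ev4 ev5 ev6 eventually_ge_at_top[of 2]
  proof eventually_elim
    case (elim N)
    interpret torus_walk N d by unfold_locales (use elim d in auto)
    define R where "R = (ln (real N) / u) powr (1 / real (d - 2))"
    have lnN: "ln (real N) > 0" using elim by simp
    have Rpow: "R ^ (d - 2) = ln (real N) / u" unfolding R_def using lnN u d by (intro powr_inverse_power) auto
    have R0: "R \<ge> 0" by (simp add: R_def)
    have cR: "1 \<le> c * R"
    proof -
      have "(1 / c) ^ (d - 2) \<le> R ^ (d - 2)" unfolding Rpow using elim u by (simp add: field_simps)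
      hence "1 / c \<le> R" by (subst (asm) power_mono_iff) (use c R0 d in auto)
      thus ?thesis using c by (simp add: field_simps)
    qed
    define m where "m = nat (radius d c N u)"
    have "real d - 2 = real (d - 2)" using d by simp
    hence rad: "radius d c N u = \<lfloor>c * R\<rfloor>" unfolding radius_def R_def by (simp only:)
    have m_le: "real m \<le> c * R" and m1: "m \<ge> 1"
      using cR by (auto simp: m_def rad le_nat_iff)
    have mpow: "real m ^ (d - 2) \<le> b * ln (real N)"
    proof -
      have "real m ^ (d - 2) \<le> (c * R) ^ (d - 2)" using m_le by (intro power_mono) auto
      also have "\<dots> = b * ln (real N)" unfolding power_mult_distrib Rpow b_def by simp
      finally show ?thesis .
    qed
    have mb: "real m \<le> b * ln (real N)"
      using order_trans[OF self_le_power[of "real m" "d - 2"] mpow] m1 d by auto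
    define q where "q = nat \<lfloor>sqrt (real N)\<rfloor>"
    define Q where "Q = nat \<lfloor>sqrt (real N) / 3\<rfloor>"
    have q: "real q \<le> sqrt (real N)" "sqrt (real N) - 1 \<le> real q" by (auto simp: q_def)
    have Q: "real Q \<le> sqrt (real N) / 3" "sqrt (real N) / 3 - 1 \<le> real Q"
    proof -
      have "0 \<le> sqrt (real N) / 3" by simp
      thus "real Q \<le> sqrt (real N) / 3" "sqrt (real N) / 3 - 1 \<le> real Q"
        unfolding Q_def by linarith+
    qed
    have Q0: "Q > 0" using elim by (simp add: Q_def)
    have "real (3 * m + Q) < real q" using mb q Q elim by simp
    hence mQq: "3 * m + Q < q" by (simp only: of_nat_less_iff)
    have qq: "q * q \<le> N"
    proof -
      have "real q * real q \<le> sqrt (real N) * sqrt (real N)" using q by (intro mult_mono) auto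
      hence "real (q * q) \<le> real N" by simp
      thus ?thesis by (simp only: of_nat_le_iff)
    qed
    define \<theta> where "\<theta> = target_const d * real m ^ (d - 2) / real N ^ d"
    have N3: "real N ^ 3 \<le> real N ^ d" using d elim by (intro power_increasing) auto
    have \<theta>m: "\<theta> * real m ^ 2 \<le> 1 / 2"
    proof -
      have "A * (real m ^ (d - 2) * real m ^ 2) \<le> A * (b * ln (real N) * (b * ln (real N)) ^ 2)"
        using A mpow mb b lnN by (intro mult_left_mono mult_mono power_mono) auto
      also have "\<dots> = A * (b * ln (real N)) ^ 3" by (simp add: power2_eq_square power3_eq_cube)
      also have "\<dots> \<le> real N ^ d / 2" using elim N3 by linarith
      finally show ?thesis using elim by (simp add: \<theta>_def A_def[symmetric] field_simps)
    qed
    have small: "target_const d * real m ^ (d - 2) \<le> sqrt (real Q) ^ (d - 2)"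
    proof -
      have "A * real m ^ (d - 2) \<le> A * (b * ln (real N))" using mpow A by (intro mult_left_mono) auto
      \<comment> \<open>In dimension 3 the right-hand side is just \<open>sqrt Q\<close>, which
        eventually exceeds any multiple of the logarithm.\<close>
      also have "\<dots> \<le> sqrt (real Q)" using elim Q by (intro real_le_rsqrt) linarith
      also have "\<dots> \<le> sqrt (real Q) ^ (d - 2)" using Q0 d by (intro self_le_power) auto
      finally show ?thesis by (simp add: A_def)
    qed
    have t0: "0 \<le> u * real N ^ d" using u by simp
    define T where "T = nat \<lfloor>u * real N ^ d\<rfloor>"
    have T: "real T \<le> u * real N ^ d" using t0 by (simp add: T_def)
    have "measure (walk_law N d) {\<omega> \<in> space (walk_law N d). L_hat N d \<omega> (u * real N ^ d) < m}
      \<le> 2 * exp (3 * \<theta> * real T) / real q"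
      unfolding T_def by (rule prob_L_hat_less_le[OF d m1 Q0 mQq qq \<theta>_def \<theta>m small t0])
    also have "\<dots> \<le> 2 * real N powr (1 / 4) / (sqrt (real N) / 2)"
    proof (intro frac_le mult_left_mono)
      have "3 * \<theta> * real T \<le> 3 * \<theta> * (u * real N ^ d)"
        using T A by (intro mult_left_mono) (auto simp: \<theta>_def A_def[symmetric])
      also have "\<dots> = 3 * A * u * real m ^ (d - 2)" using elim by (simp add: \<theta>_def A_def)
      also have "\<dots> \<le> 3 * A * u * (b * ln (real N))" using mpow A u by (intro mult_left_mono) auto
      also have "\<dots> = 3 * A * c ^ (d - 2) * ln (real N)" using u by (simp add: b_def)
      also have "\<dots> \<le> 3 * A * c * ln (real N)"
        using power_decreasing[of 1 "d - 2" c] c d A lnN by (intro mult_right_mono mult_left_mono) auto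
      also have "\<dots> \<le> 1 / 4 * ln (real N)"
        using c(3) A lnN by (intro mult_right_mono) (auto simp: A_def[symmetric] field_simps)
      finally show "exp (3 * \<theta> * real T) \<le> real N powr (1 / 4)" using elim by (simp add: powr_def)
    qed (use q elim in auto)
    also have "\<dots> = 4 * real N powr (- 1 / 4)"
    proof -
      have "sqrt (real N) = real N powr (1 / 4) * real N powr (1 / 4)"
        by (simp add: powr_half_sqrt flip: powr_add)
      thus ?thesis using elim by (simp add: powr_minus field_simps)
    qed
    finally show ?case by (simp add: m_def)
  qed
qed

theorem corollary4p8:
  fixes d :: nat
  assumes "d \<ge> 3"
  shows "\<exists>c12 c13 :: real. 0 < c13 \<and> c13 < c12 \<and>
    (\<forall>u::real. u > 0 \<longrightarrow>
      (\<lambda>N. \<P>(\<omega> in walk_law N d.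
          radius d c13 N u \<le> int (L_hat N d \<omega> (u * real N ^ d)) \<and>
          int (L_hat N d \<omega> (u * real N ^ d)) \<le> radius d c12 N u))
        \<longlonglongrightarrow> 1)"
proof -
  define c12 where "c12 = max 1 (8 * (real d + 1) / hit_const d)"
  \<comment> \<open>The bound 1/2 forces \<open>c13 < c12\<close>, since
    \<open>c12 \<ge> 1\<close>.\<close>
  define c13 where "c13 = min (1 / 2) (1 / (12 * target_const d))"
  have c13: "0 < c13" "c13 \<le> 1" "c13 \<le> 1 / (12 * target_const d)" "c13 \<le> 1 / 2"
    using target_const_pos[of d] by (auto simp: c13_def)
  have c12: "1 \<le> c12" "8 * (real d + 1) / hit_const d \<le> c12" by (auto simp: c12_def)
  have "(\<lambda>N. \<P>(\<omega> in walk_law N d.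
          radius d c13 N u \<le> int (L_hat N d \<omega> (u * real N ^ d)) \<and>
          int (L_hat N d \<omega> (u * real N ^ d)) \<le> radius d c12 N u)) \<longlonglongrightarrow> 1" (is "?P \<longlonglongrightarrow> 1")
    if u: "u > 0" for u
  proof (rule tendsto_sandwich)
    show "\<forall>\<^sub>F N in sequentially. 1 - (1 / real N + 4 * real N powr (- 1 / 4)) \<le> ?P N"
      using eventually_prob_L_hat_gt[OF assms u c12] eventually_prob_L_hat_less[OF assms u c13(1-3)]
        eventually_gt_at_top[of 0]
    proof eventually_elim
      case (elim N)
      interpret torus_walk N d by unfold_locales (use elim assms in auto)
      show ?case
        using elim(1,2) c12 c13 by (intro prob_L_hat_between_ge) (auto simp: radius_def)
    qed
    show "\<forall>\<^sub>F N in sequentially. ?P N \<le> 1"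
      using eventually_gt_at_top[of 0]
      by eventually_elim (use assms in \<open>auto intro!: prob_space.prob_le_1 prob_space_walk_law\<close>)
    show "(\<lambda>N. 1 - (1 / real N + 4 * real N powr (- 1 / 4))) \<longlonglongrightarrow> 1" by real_asymp
  qed simp
  moreover have "c13 < c12" using c12 c13 by linarith
  ultimately show ?thesis using c13(1) by blast
qed

end
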